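(* Let $F$ be a fixed graph with $\chi(F)\geq 2$. For every integer $d\geq 1$ and every $\alpha\in(0,1-1/\chi_{\mathrm{cr}}(F))$, restricting to $n$ divisible by $|V(F)|$, the function $n^{-1/d}$ is a $G^d(n,r)$-perturbed threshold for containing an $F$-factor. That is: (1) for every sequence of $n$-vertex graphs $H_n$ with $\delta(H_n)\geq\alpha n$, if $r=\omega(n^{-1/d})$ then $\lim\mathbb{P}[H_n\cup G^d(n,r)\text{ contains an }F\text{-factor}]=1$ as $n\to\infty$ over $n$ divisible by $|V(F)|$; and (2) there exists a sequence of $n$-vertex graphs $H_n$ with $\delta(H_n)\geq\alpha n$ such that, if $r=o(n^{-1/d})$, then $\lim\mathbb{P}[H_n\cup G^d(n,r)\text{ contains an }F\text{-factor}]=0$ as $n\to\infty$ over $n$ divisible by $|V(F)|$.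
   Context: Random geometric graph: let $X_1,\dots,X_n$ be independent uniform random points in $[0,1]^d$; $G^d(n,r)$ is the graph on $[n]$ with edge set $\{\{i,j\}:\|X_i-X_j\|_2\leq r\}$. For an $n$-vertex graph $H_n$ on $[n]$, $H_n\cup G^d(n,r)$ has edge set $E(H_n)\cup\{\{i,j\}:\|X_i-X_j\|_2\leq r\}$. An $F$-factor is a collection of vertex-disjoint copies of $F$ covering all vertices. For a graph $F$ with $\chi(F)\geq2$, the critical chromatic number is $\chi_{\mathrm{cr}}(F)=(\chi(F)-1)\frac{|V(F)|}{|V(F)|-\sigma(F)}$, where $\sigma(F)$ is the minimum, over all proper $\chi(F)$-colourings of $F$, of the size of the smallest colour class. A function $r^*(n)$ is a $G^d(n,r)$-perturbed threshold for a monotone property $P$ (with respect to $\alpha$) if (i) for every $H_n$ with $\delta(H_n)\ge\alpha n$, $\mathbb{P}[H_n\cup G^d(n,r)\in P]\to1$ whenever $r=\omega(r^* )$, and (ii) there is some $H_n$ with $\delta(H_n)\ge\alpha n$ such that $\mathbb{P}[H_n\cup G^d(n,r)\in P]\to0$ whenever $r=o(r^* )$. *)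

theory Defs
  imports "HOL-Probability.Probability" "HOL-Library.Landau_Symbols" "HOL-Library.Ramsey"
begin

text \<open>A finite simple graph is a pair of a vertex set \<open>V\<close> and a set \<open>E\<close> of two-element subsets of \<open>V\<close>.\<close>

definition simple_graph :: "'a set \<Rightarrow> 'a set set \<Rightarrow> bool" where
  "simple_graph V E \<longleftrightarrow> finite V \<and> E \<subseteq> nsets V 2"

definition degree :: "'a set set \<Rightarrow> 'a \<Rightarrow> nat" where
  "degree E v = card {e \<in> E. v \<in> e}"

text \<open>Only meaningful for finite nonempty \<open>V\<close>.\<close>

definition min_degree :: "'a set \<Rightarrow> 'a set set \<Rightarrow> nat" where
  "min_degree V E = (MIN v\<in>V. degree E v)"

definition proper_colouring :: "'a set \<Rightarrow> 'a set set \<Rightarrow> nat \<Rightarrow> ('a \<Rightarrow> nat) \<Rightarrow> bool" where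
  "proper_colouring V E k c \<longleftrightarrow>
     (\<forall>v\<in>V. c v < k) \<and> (\<forall>u\<in>V. \<forall>v\<in>V. {u, v} \<in> E \<longrightarrow> c u \<noteq> c v)"

definition chromatic_number :: "'a set \<Rightarrow> 'a set set \<Rightarrow> nat" where
  "chromatic_number V E = (LEAST k. \<exists>c. proper_colouring V E k c)"

definition smallest_class :: "'a set \<Rightarrow> 'a set set \<Rightarrow> nat" where
  "smallest_class V E =
     (INF c\<in>{c. proper_colouring V E (chromatic_number V E) c}.
        MIN i\<in>{..<chromatic_number V E}. card {v \<in> V. c v = i})"

definition critical_chromatic_number :: "'a set \<Rightarrow> 'a set set \<Rightarrow> real" where
  "critical_chromatic_number V E =
     (real (chromatic_number V E) - 1) *
       (real (card V) / (real (card V) - real (smallest_class V E)))"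

definition isomorphic_copy :: "'a set \<Rightarrow> 'a set set \<Rightarrow> 'b set \<Rightarrow> 'b set set \<Rightarrow> bool" where
  "isomorphic_copy VF EF W D \<longleftrightarrow> (\<exists>\<phi>. bij_betw \<phi> VF W \<and> D = (\<lambda>e. \<phi> ` e) ` EF)"

text \<open>Copies are not required to be induced subgraphs.\<close>

definition has_factor :: "'a set \<Rightarrow> 'a set set \<Rightarrow> 'b set \<Rightarrow> 'b set set \<Rightarrow> bool" where
  "has_factor VF EF V E \<longleftrightarrow>
     (\<exists>C :: ('b set \<times> 'b set set) set.
        (\<forall>(W, D)\<in>C. W \<subseteq> V \<and> D \<subseteq> E \<and> isomorphic_copy VF EF W D) \<and>
        disjoint_family_on fst C \<and> (\<Union>(W, D)\<in>C. W) = V)"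

definition geometric_edges :: "nat \<Rightarrow> real \<Rightarrow> (nat \<Rightarrow> real ^ 'd) \<Rightarrow> nat set set" where
  "geometric_edges n r x =
     {{i, j} | i j. i \<in> {1..n} \<and> j \<in> {1..n} \<and> i \<noteq> j \<and> norm (x i - x j) \<le> r}"

definition uniform_points :: "nat \<Rightarrow> (nat \<Rightarrow> real ^ 'd) measure" where
  "uniform_points n = PiM {1..n} (\<lambda>_. uniform_measure lborel (cbox 0 1))"

definition perturbed_prob ::
  "'d::finite itself \<Rightarrow> (nat set \<Rightarrow> nat set set \<Rightarrow> bool) \<Rightarrow> nat set set \<Rightarrow> nat \<Rightarrow> real \<Rightarrow> real" where
  "perturbed_prob _ P E n r =
     \<P>(x in (uniform_points n :: (nat \<Rightarrow> real ^ 'd) measure). P {1..n} (E \<union> geometric_edges n r x))"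

definition min_degree_sequence :: "nat set \<Rightarrow> real \<Rightarrow> (nat \<Rightarrow> nat set set) \<Rightarrow> bool" where
  "min_degree_sequence N \<alpha> H \<longleftrightarrow>
     (\<forall>n\<in>N. simple_graph {1..n} (H n) \<and> real (min_degree {1..n} (H n)) \<ge> \<alpha> * real n)"

text \<open>
  The filter \<open>inf sequentially (principal N)\<close> expresses \<open>n \<rightarrow> \<infinity>\<close> with \<open>n\<close> ranging over \<open>N\<close>.
  Landau symbols only see absolute values, so nonnegativity of the radius is required separately.
\<close>

definition perturbed_threshold ::
  "'d::finite itself \<Rightarrow> nat set \<Rightarrow> real \<Rightarrow> (nat set \<Rightarrow> nat set set \<Rightarrow> bool) \<Rightarrow> (nat \<Rightarrow> real) \<Rightarrow> bool" where
  "perturbed_threshold d N \<alpha> P rstar \<longleftrightarrow>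
     (\<forall>H. min_degree_sequence N \<alpha> H \<longrightarrow>
        (\<forall>r. (\<forall>n\<in>N. 0 \<le> r n) \<and> r \<in> \<omega>[inf sequentially (principal N)](rstar) \<longrightarrow>
          ((\<lambda>n. perturbed_prob d P (H n) n (r n)) \<longlongrightarrow> 1) (inf sequentially (principal N)))) \<and>
     (\<exists>H. min_degree_sequence N \<alpha> H \<and>
        (\<forall>r. (\<forall>n\<in>N. 0 \<le> r n) \<and> r \<in> o[inf sequentially (principal N)](rstar) \<longrightarrow>
          ((\<lambda>n. perturbed_prob d P (H n) n (r n)) \<longlongrightarrow> 0) (inf sequentially (principal N))))"

end

theory Submission
  imports Defs "HOL-Real_Asymp.Real_Asymp"
begin

text \<open>
  Above the threshold it suffices to tile with cliques on \<open>f = |V(F)|\<close> vertices. Cut the cube into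
  \<open>M \<le> n / K\<close> cells of diameter at most \<open>r\<close>, so that every cell spans a clique of the geometric graph,
  and set aside fewer than \<open>f\<close> leftover vertices per cell to make the remaining occupancies divisible by \<open>f\<close>.
  With high probability every vertex has many \<open>H\<close>-neighbours in all but \<open>M / (2f)\<close> of the cells. A group of \<open>f\<close>
  leftover vertices therefore has a common rich cell, and each of them forms a clique with \<open>f - 1\<close>
  of its neighbours there; this removes \<open>f (f - 1)\<close> vertices from the cell, which preserves divisibility.

  Below the threshold take for \<open>H\<close> a complete \<open>\<chi>(F)\<close>-partite graph with one class of size
  \<open>(\<sigma>(F) / f - const) n\<close>. Copies of \<open>F\<close> inside \<open>H\<close> use at least \<open>\<sigma>(F)\<close> vertices of that class,
  so an \<open>F\<close>-factor needs linearly many geometric edges, whereas their expected number is \<open>o(n)\<close>.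
\<close>

section \<open>Clique tilings from boxes\<close>

text \<open>Passing to cliques keeps only the order of F; this is affordable because cells of large
  constant expected occupancy are already cliques. What remains is divisibility: leftovers of
  different cells need not be close, so they are combined through edges of H. A fixed cell meets a
  neighbourhood in boundedly many points on average, so it may be poor with probability bounded away
  from 0, and no bound can hold for all cells at once. Hence unions of more than M / (2f) cells are
  tested: such a union has measure at least 1 / (2f) and holds few neighbours with probability
  exponentially small in n; K makes this beat the at most 2^M choices of cells. The f in 2f counts
  the vertices of a group, so that its poor cells are at most half of all cells.

  In (2) a class of H may have at most (1 - \<alpha>) n vertices. The bound on \<alpha> says that
  \<chi>(F) - 1 classes of this size would hold more than the fraction 1 - \<sigma>(F) / f of the
  vertices; this gives the linear deficit of the last class.\<close>

definition clique_tiling :: "nat \<Rightarrow> 'b set set \<Rightarrow> 'b set \<Rightarrow> bool" where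
  "clique_tiling f E V \<longleftrightarrow> (\<exists>P. partition_on V P \<and> (\<forall>K\<in>P. card K = f \<and> nsets K 2 \<subseteq> E))"

lemma nsets_2_subsetI:
  assumes "\<And>x y. x \<in> A \<Longrightarrow> y \<in> A \<Longrightarrow> x \<noteq> y \<Longrightarrow> {x, y} \<in> E"
  shows "nsets A 2 \<subseteq> E"
  using assms by (auto elim!: nsets2_E)

lemma clique_tiling_empty: "clique_tiling f E {}"
  unfolding clique_tiling_def by (intro exI[of _ "{}"]) (auto simp: partition_on_def)

lemma clique_tiling_Un:
  assumes "clique_tiling f E V" "clique_tiling f E W" "V \<inter> W = {}"
  shows "clique_tiling f E (V \<union> W)"
proof -
  obtain P Q where PQ: "partition_on V P" "partition_on W Q"
    and "\<forall>K\<in>P. card K = f \<and> nsets K 2 \<subseteq> E" "\<forall>K\<in>Q. card K = f \<and> nsets K 2 \<subseteq> E"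
    using assms unfolding clique_tiling_def by blast
  moreover have "partition_on (V \<union> W) (P \<union> Q)"
  proof (rule partition_onI)
    show "disjnt p q" if "p \<in> P \<union> Q" "q \<in> P \<union> Q" "p \<noteq> q" for p q
    proof -
      have "disjnt p q" if "p \<in> P" "q \<in> Q" for p q
        using that assms(3) partition_onD1[OF PQ(1)] partition_onD1[OF PQ(2)]
        by (auto simp: disjnt_def)
      then show ?thesis
        using that partition_onD2[OF PQ(1)] partition_onD2[OF PQ(2)]
        by (auto simp: pairwise_def disjnt_sym)
    qed
  qed (use PQ in \<open>auto dest: partition_onD1 partition_onD3\<close>)
  ultimately show ?thesis unfolding clique_tiling_def by blast
qed

lemma clique_tiling_single:
  assumes "card K = f" "0 < f" "nsets K 2 \<subseteq> E"
  shows "clique_tiling f E K"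
  unfolding clique_tiling_def using assms
  by (intro exI[of _ "{K}"]) (auto simp: partition_on_def disjoint_def)

lemma clique_tiling_UN:
  assumes "finite I" "\<And>i. i \<in> I \<Longrightarrow> clique_tiling f E (A i)" "disjoint_family_on A I"
  shows "clique_tiling f E (\<Union>i\<in>I. A i)"
  using assms
proof (induction I)
  case empty
  then show ?case by (simp add: clique_tiling_empty)
next
  case (insert i I)
  have "clique_tiling f E (A i \<union> (\<Union>i\<in>I. A i))"
  proof (rule clique_tiling_Un)
    show "clique_tiling f E (\<Union>i\<in>I. A i)"
      using insert.prems(1) by (intro insert.IH disjoint_family_on_mono[OF _ insert.prems(2)]) auto
    have "A i \<inter> A j = {}" if "j \<in> I" for j
      using insert.hyps(2) that by (intro disjoint_family_onD[OF insert.prems(2)]) auto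
    then show "A i \<inter> (\<Union>i\<in>I. A i) = {}" by blast
  qed (use insert.prems(1) in simp)
  then show ?case by simp
qed

lemma clique_tiling_clique:
  assumes "finite A" "f dvd card A" "0 < f" "nsets A 2 \<subseteq> E"
  shows "clique_tiling f E A"
  using assms
proof (induction "card A" arbitrary: A rule: less_induct)
  case less
  show ?case
  proof (cases "A = {}")
    case True
    then show ?thesis by (simp add: clique_tiling_empty)
  next
    case False
    with less.prems have "f \<le> card A" by (simp add: dvd_imp_le card_gt_0_iff)
    then obtain K where K: "K \<subseteq> A" "card K = f" "finite K"
      by (rule obtain_subset_with_card_n)
    have "card (A - K) = card A - f"
      using K by (simp add: card_Diff_subset)
    then have "clique_tiling f E (A - K)"
      using less.prems K \<open>f \<le> card A\<close> by (intro less.hyps) (auto simp: nsets_def)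
    moreover have "clique_tiling f E K"
      using K less.prems by (intro clique_tiling_single) (auto simp: nsets_def)
    ultimately have "clique_tiling f E (K \<union> (A - K))"
      by (intro clique_tiling_Un) auto
    then show ?thesis using K by (simp add: Un_absorb1)
  qed
qed

text \<open>Greedy choice: the sets chosen earlier occupy at most \<open>card I * q\<close> elements
  in total, and the lower bound for the enlarged index set leaves q further elements in the new
  \<open>A i\<close>.\<close>

lemma disjoint_subsets_of_card:
  assumes "finite I" "\<And>i. i \<in> I \<Longrightarrow> card (A i) \<ge> card I * q"
  shows "\<exists>S. (\<forall>i\<in>I. S i \<subseteq> A i \<and> card (S i) = q \<and> finite (S i)) \<and> disjoint_family_on S I"
  using assms
proof (induction I)
  case empty
  then show ?case by (simp add: disjoint_family_on_def)
next
  case (insert i I)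
  have "\<exists>S. (\<forall>i\<in>I. S i \<subseteq> A i \<and> card (S i) = q \<and> finite (S i)) \<and> disjoint_family_on S I"
  proof (rule insert.IH)
    fix j assume "j \<in> I"
    then have "card (insert i I) * q \<le> card (A j)" by (intro insert.prems) auto
    then show "card I * q \<le> card (A j)" using insert.hyps by simp
  qed
  then obtain S where S: "\<And>j. j \<in> I \<Longrightarrow> S j \<subseteq> A j \<and> card (S j) = q \<and> finite (S j)"
    "disjoint_family_on S I" by blast
  have "card (\<Union>j\<in>I. S j) \<le> (\<Sum>j\<in>I. card (S j))"
    using insert.hyps(1) by (rule card_UN_le)
  also have "\<dots> = card I * q" using S by simp
  finally have "card (\<Union>j\<in>I. S j) \<le> card I * q" .
  moreover have "card (A i) - card (\<Union>j\<in>I. S j) \<le> card (A i - (\<Union>j\<in>I. S j))"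
    using insert.hyps S by (intro diff_card_le_card_Diff) auto
  moreover have "card (A i) \<ge> card I * q + q"
    using insert.prems[of i] insert.hyps by simp
  ultimately have "q \<le> card (A i - (\<Union>j\<in>I. S j))" by linarith
  then obtain T where T: "T \<subseteq> A i - (\<Union>j\<in>I. S j)" "card T = q" "finite T"
    by (rule obtain_subset_with_card_n)
  have "disjoint_family_on (S(i := T)) (insert i I)"
    using S(2) T(1) insert.hyps(2) unfolding disjoint_family_on_def by auto
  moreover have "\<forall>j\<in>insert i I. (S(i := T)) j \<subseteq> A j \<and> card ((S(i := T)) j) = q \<and> finite ((S(i := T)) j)"
    using S T by auto
  ultimately show ?case by blast
qed

text \<open>\<open>cap b\<close> is the number of groups of leftovers that box \<open>b\<close> may still absorb. Bad boxes of a group carry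
  at most \<open>card B\<close> units of capacity in total, so \<open>cap_sum\<close> leaves a good box with positive capacity.\<close>

lemma absorb_leftovers:
  fixes box :: "'b \<Rightarrow> 'c" and B :: "'c set" and bad :: "'b \<Rightarrow> 'c set"
  assumes "0 < f" "finite B" "finite U" "finite W" "U \<inter> W = {}" "card U = k * f"
    and box: "\<And>v. v \<in> W \<Longrightarrow> box v \<in> B"
    and same_box: "\<And>v w. v \<in> W \<Longrightarrow> w \<in> W \<Longrightarrow> box v = box w \<Longrightarrow> v \<noteq> w \<Longrightarrow> {v, w} \<in> E"
    and dvd: "\<And>b. b \<in> B \<Longrightarrow> f dvd card {w \<in> W. box w = b}"
    and bad: "\<And>v. v \<in> U \<Longrightarrow> bad v \<subseteq> B \<and> 2 * f * card (bad v) \<le> card B"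
    and good: "\<And>v b. v \<in> U \<Longrightarrow> b \<in> B - bad v \<Longrightarrow>
       cap b * f^2 \<le> card {w \<in> W. box w = b \<and> {v, w} \<in> E}"
    and cap_le: "\<And>b. b \<in> B \<Longrightarrow> cap b \<le> 2"
    and cap_sum: "card B + k \<le> (\<Sum>b\<in>B. cap b)"
  shows "clique_tiling f E (U \<union> W)"
  using assms(3-)
proof (induction k arbitrary: U W cap)
  case 0
  have "clique_tiling f E (\<Union>b\<in>B. {w \<in> W. box w = b})"
  proof (rule clique_tiling_UN)
    show "clique_tiling f E {w \<in> W. box w = b}" if "b \<in> B" for b
    proof (rule clique_tiling_clique)
      show "nsets {w \<in> W. box w = b} 2 \<subseteq> E"
        by (rule nsets_2_subsetI) (use "0.prems"(6) in auto)
    qed (use 0 that assms in auto)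
  qed (auto simp: assms disjoint_family_on_def)
  moreover have "(\<Union>b\<in>B. {w \<in> W. box w = b}) = W" using 0 by auto
  moreover have "U = {}" using 0 by simp
  ultimately show ?case by simp
next
  case (Suc k)
  note p = Suc.prems
  have "f \<le> card U" using p(4) by simp
  then obtain I where I: "I \<subseteq> U" "card I = f" "finite I" by (rule obtain_subset_with_card_n)
  define Bad where "Bad = (\<Union>v\<in>I. bad v)"
  have "Bad \<subseteq> B" using p(8) I unfolding Bad_def by blast
  have "card Bad \<le> (\<Sum>v\<in>I. card (bad v))"
    unfolding Bad_def using I(3) by (rule card_UN_le)
  then have "2 * f * card Bad \<le> (\<Sum>v\<in>I. 2 * f * card (bad v))"
    by (simp flip: sum_distrib_left)
  also have "\<dots> \<le> (\<Sum>v\<in>I. card B)"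
    using p(8) I by (intro sum_mono) blast
  also have "\<dots> = f * card B" using I by simp
  \<comment> \<open>The factor \<open>2 * f\<close> in the bound on \<open>bad v\<close> is made for
    this: the f bad sets of a group cover at most half of B, which at capacity at most 2 per box is
    worth at most \<open>card B\<close> units.\<close>
  finally have "2 * card Bad \<le> card B" using \<open>0 < f\<close> by simp
  have "(\<Sum>b\<in>Bad. cap b) \<le> (\<Sum>b\<in>Bad. 2)"
    using p(10) \<open>Bad \<subseteq> B\<close> by (intro sum_mono) auto
  then have "(\<Sum>b\<in>Bad. cap b) \<le> card B" using \<open>2 * card Bad \<le> card B\<close> by simp
  then have "(\<Sum>b\<in>Bad. cap b) < (\<Sum>b\<in>B. cap b)" using p(11) by simp
  then have "(\<Sum>b\<in>B - Bad. cap b) > 0"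
    using sum.subset_diff[OF \<open>Bad \<subseteq> B\<close> \<open>finite B\<close>, of cap] by simp
  then obtain b where b: "b \<in> B" "b \<notin> Bad" "0 < cap b"
    by (metis DiffE gr0I less_irrefl sum.neutral)
  have "\<exists>S. (\<forall>v\<in>I. S v \<subseteq> {w \<in> W. box w = b \<and> {v, w} \<in> E} \<and> card (S v) = f - 1 \<and> finite (S v))
      \<and> disjoint_family_on S I"
  proof (rule disjoint_subsets_of_card[OF I(3)])
    fix v assume v: "v \<in> I"
    \<comment> \<open>One unit of capacity stands for \<open>f^2\<close> neighbours: enough for the
      greedy choice of f disjoint sets of size \<open>f - 1\<close>, and enough to pay for the
      neighbours lost when T leaves the box.\<close>
    have "card I * (f - 1) \<le> f^2" using I by (simp add: power2_eq_square)
    also have "\<dots> \<le> cap b * f^2" using b by simp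
    also have "\<dots> \<le> card {w \<in> W. box w = b \<and> {v, w} \<in> E}"
      using p(9) v b I unfolding Bad_def by auto
    finally show "card I * (f - 1) \<le> card {w \<in> W. box w = b \<and> {v, w} \<in> E}" .
  qed
  then obtain S where S: "\<And>v. v \<in> I \<Longrightarrow> S v \<subseteq> {w \<in> W. box w = b \<and> {v, w} \<in> E}"
    "\<And>v. v \<in> I \<Longrightarrow> card (S v) = f - 1" "\<And>v. v \<in> I \<Longrightarrow> finite (S v)" "disjoint_family_on S I"
    by blast
  define T where "T = (\<Union>v\<in>I. S v)"
  have T: "finite T" "T \<subseteq> {w \<in> W. box w = b}" using S I unfolding T_def by blast+
  have card_T: "card T = f * (f - 1)"
    using S I unfolding T_def by (simp add: card_UN_disjoint' )
  have "clique_tiling f E (\<Union>v\<in>I. insert v (S v))"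
  proof (rule clique_tiling_UN[OF I(3)])
    fix v assume v: "v \<in> I"
    have "v \<notin> S v" using S(1)[OF v] v I p(3) by blast
    show "clique_tiling f E (insert v (S v))"
    proof (rule clique_tiling_single)
      show "card (insert v (S v)) = f" using S(2,3)[OF v] \<open>v \<notin> S v\<close> \<open>0 < f\<close> by simp
      show "nsets (insert v (S v)) 2 \<subseteq> E"
      proof (rule nsets_2_subsetI)
        fix x y assume xy: "x \<in> insert v (S v)" "y \<in> insert v (S v)" "x \<noteq> y"
        consider "x = v" "y \<in> S v" | "y = v" "x \<in> S v" | "x \<in> S v" "y \<in> S v" using xy by blast
        then show "{x, y} \<in> E"
        proof cases
          case 2
          then have "{y, x} \<in> E" using S(1)[OF v] by blast
          then show ?thesis by (simp add: insert_commute)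
        next
          case 3
          then show ?thesis using S(1)[OF v] xy(3) p(6)[of x y] by blast
        qed (use S(1)[OF v] in blast)
      qed
    qed fact
  next
    show "disjoint_family_on (\<lambda>v. insert v (S v)) I"
      unfolding disjoint_family_on_def
    proof (intro ballI impI)
      fix v w assume vw: "v \<in> I" "w \<in> I" "v \<noteq> w"
      then have "S v \<inter> S w = {}" using S(4) unfolding disjoint_family_on_def by blast
      moreover have "v \<notin> S w" "w \<notin> S v" using S(1)[of v] S(1)[of w] vw I(1) p(3) by blast+
      ultimately show "insert v (S v) \<inter> insert w (S w) = {}" using vw by blast
    qed
  qed
  moreover have "clique_tiling f E ((U - I) \<union> (W - T))"
  proof (rule Suc.IH[where cap = "cap(b := cap b - 1)"])
    show "card (U - I) = k * f" using I p(1,4) by (simp add: card_Diff_subset)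
    show "f dvd card {w \<in> W - T. box w = c}" if "c \<in> B" for c
    proof (cases "c = b")
      case True
      have "{w \<in> W - T. box w = c} = {w \<in> W. box w = b} - T" using True by blast
      then show ?thesis using T p(7)[OF that] card_T True by (simp add: card_Diff_subset)
    next
      case False
      then have "{w \<in> W - T. box w = c} = {w \<in> W. box w = c}" using T by auto
      then show ?thesis using p(7)[OF that] by simp
    qed
    show "(cap(b := cap b - 1)) c * f\<^sup>2 \<le> card {w \<in> W - T. box w = c \<and> {v, w} \<in> E}"
      if v: "v \<in> U - I" and c: "c \<in> B - bad v" for v c
    proof (cases "c = b")
      case True
      let ?N = "{w \<in> W. box w = c \<and> {v, w} \<in> E}"
      have eq: "{w \<in> W - T. box w = c \<and> {v, w} \<in> E} = ?N - T" by blast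
      have "card T \<le> f^2" using card_T by (simp add: power2_eq_square)
      moreover have "card ?N - card T \<le> card (?N - T)"
        using T by (intro diff_card_le_card_Diff) auto
      moreover have "cap b * f^2 \<le> card ?N" using p(9)[of v c] v c True by auto
      ultimately show ?thesis unfolding eq using True by (simp add: diff_mult_distrib)
    next
      case False
      then have "{w \<in> W - T. box w = c \<and> {v, w} \<in> E} = {w \<in> W. box w = c \<and> {v, w} \<in> E}"
        using T by auto
      then show ?thesis using p(9)[of v c] v c False by auto
    qed
    have "sum (cap(b := cap b - 1)) B = sum cap B - 1"
    proof -
      have "sum (cap(b := cap b - 1)) B = (cap b - 1) + sum cap (B - {b})"
        using b \<open>finite B\<close> by (simp add: sum.remove)
      moreover have "sum cap B = cap b + sum cap (B - {b})"
        using b \<open>finite B\<close> by (simp add: sum.remove)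
      ultimately show ?thesis using b by simp
    qed
    then show "card B + k \<le> sum (cap(b := cap b - 1)) B" using p(11) by simp
    show "(cap(b := cap b - 1)) c \<le> 2" if "c \<in> B" for c
      using p(10)[OF that] by auto
    show "{v, w} \<in> E" if "v \<in> W - T" "w \<in> W - T" "box v = box w" "v \<noteq> w" for v w
      using p(6) that by blast
    show "bad v \<subseteq> B \<and> 2 * f * card (bad v) \<le> card B" if "v \<in> U - I" for v
      using p(8) that by blast
    show "(U - I) \<inter> (W - T) = {}" using p(3) by blast
  qed (use p(1,2,5) in auto)
  moreover have "(\<Union>v\<in>I. insert v (S v)) = I \<union> T" unfolding T_def by blast
  ultimately have "clique_tiling f E ((I \<union> T) \<union> ((U - I) \<union> (W - T)))"
    by (intro clique_tiling_Un[of f E "I \<union> T"]) (use I T p(3) in auto)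
  moreover have "(I \<union> T) \<union> ((U - I) \<union> (W - T)) = U \<union> W" using I T by blast
  ultimately show ?case by simp
qed

text \<open>Each box sheds fewer than f vertices, so there are at most \<open>card B\<close> groups
  of leftovers, and capacity 2 in every box satisfies the budget of \<open>absorb_leftovers\<close>.
  The threshold \<open>2 * f^2 + f\<close> pays for these two units after the box has lost its own
  leftovers.\<close>

lemma clique_tiling_of_boxes:
  fixes box :: "'b \<Rightarrow> 'c" and B :: "'c set"
  assumes "0 < f" "finite B" "finite V" "f dvd card V"
    and box: "\<And>v. v \<in> V \<Longrightarrow> box v \<in> B"
    and same_box: "\<And>v w. v \<in> V \<Longrightarrow> w \<in> V \<Longrightarrow> box v = box w \<Longrightarrow> v \<noteq> w \<Longrightarrow> {v, w} \<in> E"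
    and few_poor: "\<And>v. v \<in> V \<Longrightarrow>
      2 * f * card {b \<in> B. card {w \<in> V. box w = b \<and> {v, w} \<in> E} < 2 * f^2 + f} \<le> card B"
  shows "clique_tiling f E V"
proof -
  have "\<exists>L. L \<subseteq> {v \<in> V. box v = b} \<and> card L = card {v \<in> V. box v = b} mod f" for b
    by (meson obtain_subset_with_card_n mod_less_eq_dividend)
  then obtain L where L: "\<And>b. L b \<subseteq> {v \<in> V. box v = b}"
    "\<And>b. card (L b) = card {v \<in> V. box v = b} mod f" by metis
  have fin_L: "finite (L b)" for b using L(1)[of b] \<open>finite V\<close> by (auto intro: finite_subset)
  define U where "U = (\<Union>b\<in>B. L b)"
  have "U \<subseteq> V" using L(1) unfolding U_def by blast
  have "finite U" using \<open>U \<subseteq> V\<close> \<open>finite V\<close> by (rule finite_subset)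
  have box_diff: "{w \<in> V - U. box w = b} = {w \<in> V. box w = b} - L b" if "b \<in> B" for b
    using L(1) that unfolding U_def by blast
  have dvd: "f dvd card {w \<in> V - U. box w = b}" if "b \<in> B" for b
    unfolding box_diff[OF that] using fin_L L \<open>finite V\<close>
    by (simp add: card_Diff_subset minus_mod_eq_mult_div)
  have "V - U = (\<Union>b\<in>B. {w \<in> V - U. box w = b})" using box by auto
  then have "card (V - U) = card (\<Union>b\<in>B. {w \<in> V - U. box w = b})" by (rule arg_cong)
  also have "\<dots> = (\<Sum>b\<in>B. card {w \<in> V - U. box w = b})"
    using \<open>finite B\<close> \<open>finite V\<close> by (intro card_UN_disjoint) auto
  finally have "f dvd card (V - U)" using dvd by (simp add: dvd_sum)
  moreover have "card V = card U + card (V - U)"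
    using \<open>U \<subseteq> V\<close> \<open>finite V\<close> by (simp add: card_Diff_subset finite_subset card_mono)
  \<comment> \<open>Divisibility of the whole vertex set enters here: all trimmed boxes have size
    divisible by f, so the leftovers split into groups of exactly f.\<close>
  ultimately have "f dvd card U" using \<open>f dvd card V\<close> by (metis dvd_add_left_iff)
  then obtain k where k: "card U = k * f" by (auto simp: dvd_def mult.commute)
  have "card U \<le> (\<Sum>b\<in>B. card (L b))" unfolding U_def using \<open>finite B\<close> by (rule card_UN_le)
  also have "\<dots> \<le> (\<Sum>b\<in>B. f)" using L(2) \<open>0 < f\<close> by (intro sum_mono) (simp add: less_imp_le)
  finally have "k \<le> card B" using k \<open>0 < f\<close> by simp
  have "clique_tiling f E (U \<union> (V - U))"
  proof (rule absorb_leftovers[where box = box and B = B and cap = "\<lambda>_. 2"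
        and bad = "\<lambda>v. {b \<in> B. card {w \<in> V. box w = b \<and> {v, w} \<in> E} < 2 * f^2 + f}"])
    show "2 * f^2 \<le> card {w \<in> V - U. box w = b \<and> {v, w} \<in> E}"
      if "v \<in> U" "b \<in> B - {b \<in> B. card {w \<in> V. box w = b \<and> {v, w} \<in> E} < 2 * f^2 + f}" for v b
    proof -
      have eq: "{w \<in> V - U. box w = b \<and> {v, w} \<in> E} = {w \<in> V. box w = b \<and> {v, w} \<in> E} - L b"
        using that L(1) unfolding U_def by blast
      have "card {w \<in> V. box w = b \<and> {v, w} \<in> E} - card (L b)
          \<le> card ({w \<in> V. box w = b \<and> {v, w} \<in> E} - L b)"
        using fin_L by (intro diff_card_le_card_Diff)
      moreover have "card (L b) \<le> f" using L(2) \<open>0 < f\<close> by (simp add: less_imp_le)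
      moreover have "2 * f^2 + f \<le> card {w \<in> V. box w = b \<and> {v, w} \<in> E}"
        using that(2) by (simp add: not_less)
      ultimately show ?thesis unfolding eq by linarith
    qed
    show "{v, w} \<in> E" if "v \<in> V - U" "w \<in> V - U" "box v = box w" "v \<noteq> w" for v w
      using same_box that by blast
    show "{b \<in> B. card {w \<in> V. box w = b \<and> {v, w} \<in> E} < 2 * f^2 + f} \<subseteq> B \<and>
        2 * f * card {b \<in> B. card {w \<in> V. box w = b \<and> {v, w} \<in> E} < 2 * f^2 + f} \<le> card B"
      if "v \<in> U" for v
      using few_poor \<open>U \<subseteq> V\<close> that by blast
    show "card B + k \<le> (\<Sum>b\<in>B. 2)" using \<open>k \<le> card B\<close> by simp
    show "card U = k * f" by fact
  qed (use \<open>0 < f\<close> \<open>finite B\<close> \<open>finite U\<close> \<open>finite V\<close> box dvd in auto)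
  then show ?thesis using \<open>U \<subseteq> V\<close> by (simp add: Un_absorb1)
qed

text \<open>Inside a clique every bijection from \<open>VF\<close> sends edges to edges, so one
  arbitrary bijection per part produces the copies.\<close>

lemma has_factor_if_clique_tiling:
  assumes "simple_graph VF EF" "VF \<noteq> {}" "clique_tiling (card VF) E V"
  shows "has_factor VF EF V E"
proof -
  have fin: "finite VF" and EF: "EF \<subseteq> nsets VF 2" using assms by (auto simp: simple_graph_def)
  have pos: "0 < card VF" using fin assms(2) by (simp add: card_gt_0_iff)
  obtain P where P: "partition_on V P" "\<And>K. K \<in> P \<Longrightarrow> card K = card VF"
    "\<And>K. K \<in> P \<Longrightarrow> nsets K 2 \<subseteq> E"
    using assms(3) unfolding clique_tiling_def by blast
  have "\<exists>\<phi>. bij_betw \<phi> VF K" if "K \<in> P" for K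
    using P(2)[OF that] fin pos by (intro finite_same_card_bij) (auto intro: card_ge_0_finite)
  then obtain \<phi> where \<phi>: "\<And>K. K \<in> P \<Longrightarrow> bij_betw (\<phi> K) VF K" by metis
  define C where "C = (\<lambda>K. (K, (\<lambda>e. \<phi> K ` e) ` EF)) ` P"
  have "(\<lambda>e. \<phi> K ` e) ` EF \<subseteq> E" if "K \<in> P" for K
  proof
    fix e assume "e \<in> (\<lambda>e. \<phi> K ` e) ` EF"
    then obtain e' where e': "e' \<in> EF" "e = \<phi> K ` e'" by blast
    have inj: "inj_on (\<phi> K) VF" "\<phi> K ` VF = K" using \<phi>[OF that] by (auto simp: bij_betw_def)
    have "e' \<subseteq> VF" "finite e'" "card e' = 2" using e' EF by (auto simp: nsets_def)
    then have "e \<in> nsets K 2"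
      using inj e' by (auto simp: nsets_def card_image inj_on_subset)
    then show "e \<in> E" using P(3)[OF that] by blast
  qed
  moreover have "K \<subseteq> V" if "K \<in> P" for K using P(1) that by (auto simp: partition_on_def)
  moreover have "isomorphic_copy VF EF K ((\<lambda>e. \<phi> K ` e) ` EF)" if "K \<in> P" for K
    using \<phi>[OF that] unfolding isomorphic_copy_def by blast
  moreover have "disjoint_family_on fst C"
    using P(1) unfolding C_def disjoint_family_on_def partition_on_def disjoint_def by auto
  moreover have "(\<Union>(W, D)\<in>C. W) = V" using P(1) unfolding C_def partition_on_def by auto
  ultimately show ?thesis
    unfolding has_factor_def by (intro exI[of _ C]) (auto simp: C_def)
qed

section \<open>Uniform points in the cube\<close>

lemma emeasure_unit_cube: "emeasure lborel (cbox 0 1 :: (real ^ 'd) set) = 1"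
proof -
  have "(1 :: real ^ 'd) \<bullet> b = 1" if "b \<in> Basis" for b
    using that by (auto simp: Basis_vec_def inner_axis)
  then show ?thesis by simp
qed

lemma prob_space_unit_cube: "prob_space (uniform_measure lborel (cbox 0 1 :: (real ^ 'd) set))"
  by (rule prob_space_uniform_measure) (simp_all add: emeasure_unit_cube)

lemma measure_unit_cube:
  assumes "T \<in> sets borel"
  shows "measure (uniform_measure lborel (cbox 0 1 :: (real ^ 'd) set)) T = measure lborel (cbox 0 1 \<inter> T)"
  using assms emeasure_unit_cube[where 'd = 'd]
  by (subst measure_uniform_measure) (auto simp: measure_def)

lemma prob_space_uniform_points: "prob_space (uniform_points n :: (nat \<Rightarrow> real ^ 'd) measure)"
  unfolding uniform_points_def by (intro prob_space_PiM prob_space_unit_cube)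

lemma uniform_points_component_measurable [measurable]:
  assumes "i \<in> {1..n}"
  shows "(\<lambda>x. x i) \<in> (uniform_points n :: (nat \<Rightarrow> real ^ 'd) measure) \<rightarrow>\<^sub>M borel"
proof -
  have "(\<lambda>x. x i) \<in> (uniform_points n :: (nat \<Rightarrow> real ^ 'd) measure)
      \<rightarrow>\<^sub>M uniform_measure lborel (cbox 0 1)"
    unfolding uniform_points_def using assms by (rule measurable_component_singleton)
  also have "?this \<longleftrightarrow> ?thesis" 
    by (rule arg_cong[where f = "\<lambda>S. _ \<in> S"], rule measurable_cong_sets) auto
  finally show ?thesis .
qed

text \<open>The sample space of \<open>uniform_points\<close> consists of points of all of
  \<open>real ^ 'd\<close>; only the mass is confined to the cube. The geometry of the cells is
  therefore available almost surely, not for every sample.\<close>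

lemma AE_uniform_points_in_cube:
  "AE x in (uniform_points n :: (nat \<Rightarrow> real ^ 'd) measure). \<forall>i\<in>{1..n}. x i \<in> cbox 0 1"
  unfolding uniform_points_def
  by (intro eventually_ball_finite ballI AE_PiM_component prob_space_unit_cube AE_uniform_measureI)
    auto

section \<open>Measurability of events about the geometric graph\<close>

lemma doubleton_in_geometric_edges:
  assumes "i \<in> {1..n}" "j \<in> {1..n}" "i \<noteq> j"
  shows "{i, j} \<in> geometric_edges n r x \<longleftrightarrow> norm (x i - x j) \<le> r"
  using assms by (auto simp: geometric_edges_def doubleton_eq_iff norm_minus_commute)

lemma geometric_edges_subset: "geometric_edges n r x \<subseteq> nsets {1..n} 2"
  by (auto simp: geometric_edges_def)

lemma finite_geometric_edges: "finite (geometric_edges n r x)"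
  by (rule finite_subset[OF geometric_edges_subset]) (simp add: finite_imp_finite_nsets)

text \<open>There are finitely many possible edge sets on \<open>{1..n}\<close>, and each is
  attained on a finite Boolean combination of distance conditions. With the discrete target, every
  event about the perturbed graph becomes measurable, however complicated the graph property
  is.\<close>

lemma measurable_geometric_edges [measurable]:
  "geometric_edges n r \<in> (uniform_points n :: (nat \<Rightarrow> real ^ 'd) measure) \<rightarrow>\<^sub>M count_space UNIV"
proof (rule measurable_compose[where N = "count_space (Pow (nsets {1..n} 2))" and g = "\<lambda>G. G"])
  have [measurable]: "Measurable.pred (uniform_points n :: (nat \<Rightarrow> real ^ 'd) measure)
      (\<lambda>x. norm (x i - x j) \<le> r)" if "i \<in> {1..n}" "j \<in> {1..n}" for i j
    using that by measurable
  show "geometric_edges n r \<in> (uniform_points n :: (nat \<Rightarrow> real ^ 'd) measure)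
      \<rightarrow>\<^sub>M count_space (Pow (nsets {1..n} 2))"
  proof (subst measurable_count_space_eq2)
    show "finite (Pow (nsets {1..n} 2))" by (simp add: finite_imp_finite_nsets)
    have "geometric_edges n r -` {G} \<inter> space (uniform_points n :: (nat \<Rightarrow> real ^ 'd) measure)
        \<in> sets (uniform_points n)" if "G \<subseteq> nsets {1..n} 2" for G
    proof -
      have eq: "geometric_edges n r -` {G} \<inter> space (uniform_points n :: (nat \<Rightarrow> real ^ 'd) measure)
         = {x \<in> space (uniform_points n). \<forall>i\<in>{1..n}. \<forall>j\<in>{1..n}.
              i \<noteq> j \<longrightarrow> (norm (x i - x j) \<le> r \<longleftrightarrow> {i, j} \<in> G)}"
        (is "?L = ?R")
      proof (intro set_eqI iffI)
        fix x assume "x \<in> ?L"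
        then have "geometric_edges n r x = G" "x \<in> space (uniform_points n)" by auto
        then show "x \<in> ?R" using doubleton_in_geometric_edges[of _ n _ r x] by blast
      next
        fix x assume x: "x \<in> ?R"
        have "e \<in> geometric_edges n r x \<longleftrightarrow> e \<in> G" for e
        proof (cases "e \<in> nsets {1..n} 2")
          case True
          then obtain i j where ij: "e = {i, j}" "i \<in> {1..n}" "j \<in> {1..n}" "i \<noteq> j"
            by (rule nsets2_E)
          then show ?thesis using x doubleton_in_geometric_edges[of i n j r x] by blast
        next
          case False
          then show ?thesis using that geometric_edges_subset[of n r x] by blast
        qed
        then show "x \<in> ?L" using x by auto
      qed
      show ?thesis unfolding eq by measurable
    qed
    then show "geometric_edges n r \<in> space (uniform_points n :: (nat \<Rightarrow> real ^ 'd) measure)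
        \<rightarrow> Pow (nsets {1..n} 2) \<and> (\<forall>a\<in>Pow (nsets {1..n} 2).
        geometric_edges n r -` {a} \<inter> space (uniform_points n :: (nat \<Rightarrow> real ^ 'd) measure)
          \<in> sets (uniform_points n))"
      by (intro conjI Pi_I PowI ballI geometric_edges_subset) blast
  qed
qed simp

lemma sets_uniform_points_edges:
  "{x \<in> space (uniform_points n :: (nat \<Rightarrow> real ^ 'd) measure). Q (geometric_edges n r x)}
     \<in> sets (uniform_points n)"
proof -
  have "Measurable.pred (uniform_points n :: (nat \<Rightarrow> real ^ 'd) measure) (\<lambda>x. Q (geometric_edges n r x))"
    by (rule measurable_compose[OF measurable_geometric_edges]) simp
  then show ?thesis by simp
qed

section \<open>Tail estimates: few points in a region, close pairs, many edges\<close>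

lemma sets_few_points:
  assumes "finite I" "J \<subseteq> I" "T \<in> sets M"
  shows "{x \<in> space (PiM I (\<lambda>_. M)). card {j \<in> J. x j \<in> T} \<le> a} \<in> sets (PiM I (\<lambda>_. M))"
proof -
  have [measurable]: "T \<in> sets M" by fact
  have [measurable]: "(\<lambda>x. x j) \<in> PiM I (\<lambda>_. M) \<rightarrow>\<^sub>M M" if "j \<in> J" for j
    using that assms(2) by (intro measurable_component_singleton) auto
  have "finite J" using assms by (auto intro: finite_subset)
  then have card_eq: "real (card {j \<in> J. x j \<in> T}) = (\<Sum>j\<in>J. indicator T (x j))" for x
    by (simp add: indicator_def Int_def)
  have "{x \<in> space (PiM I (\<lambda>_. M)). card {j \<in> J. x j \<in> T} \<le> a}
      = {x \<in> space (PiM I (\<lambda>_. M)). (\<Sum>j\<in>J. indicator T (x j)) \<le> real a}"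
    by (simp flip: card_eq)
  also have "\<dots> \<in> sets (PiM I (\<lambda>_. M))" by measurable
  finally show ?thesis .
qed

text \<open>Markov's inequality for \<open>2 ^ - card {j \<in> J. x j \<in> T}\<close>, which is a product over the points.\<close>

lemma prob_few_points_le:
  assumes "prob_space M" "finite I" "J \<subseteq> I" "T \<in> sets M"
  shows "\<P>(x in PiM I (\<lambda>_. M). card {j \<in> J. x j \<in> T} \<le> a) \<le> 2 ^ a * (1 - measure M T / 2) ^ card J"
proof -
  interpret M: prob_space M by fact
  interpret product_prob_space "\<lambda>_. M" I
    by (simp add: product_prob_space_def product_prob_space_axioms_def product_sigma_finite_def
        M.sigma_finite_measure_axioms M.prob_space_axioms)
  have [measurable]: "T \<in> sets M" by fact
  have "finite J" using assms by (auto intro: finite_subset)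
  \<comment> \<open>For i in J this is 2 to the power of minus the indicator, written affinely so
    that its expectation is \<open>1 - measure M T / 2\<close>; indices outside J contribute the
    factor 1.\<close>
  define f where "f = (\<lambda>i y. if i \<in> J then 1 - indicator T y / 2 else (1 :: real))"
  have f_int: "integrable M (f i)" for i 
    by (rule M.integrable_const_bound[where B = 1]) (auto simp: f_def indicator_def)
  have prod_eq: "(\<Prod>i\<in>I. f i (x i)) = (1 / 2) ^ card {j \<in> J. x j \<in> T}" for x
  proof -
    have "(\<Prod>i\<in>I. f i (x i)) = (\<Prod>i\<in>I. if i \<in> {j \<in> J. x j \<in> T} then 1 / 2 else 1)"
      by (intro prod.cong) (auto simp: f_def indicator_def)
    also have "\<dots> = (\<Prod>i\<in>I \<inter> {j \<in> J. x j \<in> T}. 1 / 2)"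
      using \<open>finite I\<close> by (rule prod.inter_restrict[symmetric])
    also have "I \<inter> {j \<in> J. x j \<in> T} = {j \<in> J. x j \<in> T}" using assms by auto
    finally show ?thesis by simp
  qed
  let ?A = "{x \<in> space (PiM I (\<lambda>_. M)). card {j \<in> J. x j \<in> T} \<le> a}"
  have A: "?A \<in> sets (PiM I (\<lambda>_. M))" using assms(2-4) by (rule sets_few_points)
  have "measure (PiM I (\<lambda>_. M)) ?A = (\<integral>x. indicator ?A x \<partial>PiM I (\<lambda>_. M))" using A by simp
  also have "\<dots> \<le> (\<integral>x. 2 ^ a * (\<Prod>i\<in>I. f i (x i)) \<partial>PiM I (\<lambda>_. M))"
  proof (rule integral_mono)
    show "integrable (PiM I (\<lambda>_. M)) (indicator ?A :: _ \<Rightarrow> real)"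
      using A by (simp add: less_top[symmetric])
    show "integrable (PiM I (\<lambda>_. M)) (\<lambda>x. 2 ^ a * (\<Prod>i\<in>I. f i (x i)))"
      using \<open>finite I\<close> f_int by (intro integrable_mult_right product_integrable_prod) auto
    fix x
    show "indicator ?A x \<le> (2 ^ a * (\<Prod>i\<in>I. f i (x i)) :: real)"
      unfolding prod_eq by (auto simp: indicator_def power_one_over field_simps power_increasing)
  qed
  also have "\<dots> = 2 ^ a * (\<Prod>i\<in>I. integral\<^sup>L M (f i))"
    using \<open>finite I\<close> f_int by (simp add: product_integral_prod)
  also have "(\<Prod>i\<in>I. integral\<^sup>L M (f i)) = (\<Prod>i\<in>I. if i \<in> J then 1 - measure M T / 2 else 1)"
  proof (intro prod.cong refl)
    have "integrable M (\<lambda>y. indicator T y / 2 :: real)"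
      by (rule M.integrable_const_bound[where B = 1]) (auto simp: indicator_def)
    then show "integral\<^sup>L M (f i) = (if i \<in> J then 1 - measure M T / 2 else 1)" for i
      by (auto simp: f_def M.prob_space)
  qed
  also have "\<dots> = (1 - measure M T / 2) ^ card J"
  proof -
    have "I \<inter> J = J" using assms by auto
    then show ?thesis using \<open>finite I\<close> by (simp flip: prod.inter_restrict)
  qed
  finally show ?thesis .
qed

text \<open>With all points except the j-th frozen, the j-th has to fall into a ball around
  \<open>x i\<close>, and that ball lies in a cube of side \<open>2 * r\<close>. Fubini then removes
  the conditioning. Only the order \<open>r ^ CARD('d)\<close> matters later.\<close>

lemma prob_close_le:
  assumes "i \<in> {1..n}" "j \<in> {1..n}" "i \<noteq> j" "0 \<le> r"
  shows "\<P>(x in (uniform_points n :: (nat \<Rightarrow> real ^ 'd) measure). norm (x i - x j) \<le> r)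
    \<le> (2 * r) ^ CARD('d)"
proof -
  let ?M = "uniform_measure lborel (cbox 0 1 :: (real ^ 'd) set)"
  let ?J = "{1..n} - {j}"
  interpret M: prob_space ?M by (rule prob_space_unit_cube)
  interpret product_prob_space "\<lambda>_. ?M" ?J
    by (simp add: product_prob_space_def product_prob_space_axioms_def product_sigma_finite_def
        M.sigma_finite_measure_axioms M.prob_space_axioms)
  interpret U: prob_space "uniform_points n :: (nat \<Rightarrow> real ^ 'd) measure"
    by (rule prob_space_uniform_points)
  have ins: "insert j ?J = {1..n}" using assms by auto
  let ?A = "{x \<in> space (uniform_points n :: (nat \<Rightarrow> real ^ 'd) measure). norm (x i - x j) \<le> r}"
  have A [measurable]: "?A \<in> sets (uniform_points n)" using assms by measurable
  have inner: "emeasure ?M {y. norm (z - y) \<le> r} \<le> ennreal ((2 * r) ^ CARD('d))" for z :: "real ^ 'd"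
  proof -
    let ?B = "cbox (\<chi> k. z $ k - r) (\<chi> k. z $ k + r)"
    have "{y. norm (z - y) \<le> r} \<subseteq> ?B"
    proof
      fix y assume "y \<in> {y. norm (z - y) \<le> r}"
      then have "\<bar>(z - y) $ k\<bar> \<le> r" for k
        using component_le_norm_cart[of "z - y" k] by simp
      then show "y \<in> ?B" by (auto simp: mem_box_cart abs_le_iff) (smt (verit) vector_minus_component)+
    qed
    have meas: "{y. norm (z - y) \<le> r} \<in> sets borel" by measurable
    then have "emeasure ?M {y. norm (z - y) \<le> r} = emeasure lborel (cbox 0 1 \<inter> {y. norm (z - y) \<le> r})"
      by (simp add: emeasure_uniform_measure emeasure_unit_cube divide_ennreal_def)
    also have "\<dots> \<le> emeasure lborel ?B"
      using \<open>{y. norm (z - y) \<le> r} \<subseteq> ?B\<close> by (intro emeasure_mono) auto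
    also have "\<dots> = ennreal ((2 * r) ^ CARD('d))"
    proof -
      have l: "(\<chi> k. z $ k - r) \<bullet> b \<le> (\<chi> k. z $ k + r) \<bullet> b"
        and d: "((\<chi> k. z $ k + r) - (\<chi> k. z $ k - r)) \<bullet> b = 2 * r" if "b \<in> Basis" for b :: "real ^ 'd"
        using that assms(4) by (auto simp: Basis_vec_def inner_axis)
      have "(\<Prod>b\<in>(Basis :: (real ^ 'd) set). ((\<chi> k. z $ k + r) - (\<chi> k. z $ k - r)) \<bullet> b)
          = (2 * r) ^ CARD('d)"
        using d by simp
      then show ?thesis using l by (simp only: emeasure_lborel_cbox)
    qed
    finally show ?thesis .
  qed
  have "emeasure (uniform_points n) ?A = (\<integral>\<^sup>+ x. indicator ?A x \<partial>uniform_points n)" using A by simp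
  also have "\<dots> = (\<integral>\<^sup>+ x. indicator ?A x \<partial>PiM (insert j ?J) (\<lambda>_. ?M))"
    unfolding ins uniform_points_def ..
  also have "\<dots> = (\<integral>\<^sup>+ x. (\<integral>\<^sup>+ y. indicator ?A (x(j := y)) \<partial>?M) \<partial>PiM ?J (\<lambda>_. ?M))"
  proof (rule product_nn_integral_insert)
    show "(indicator ?A :: _ \<Rightarrow> ennreal) \<in> borel_measurable (PiM (insert j ?J) (\<lambda>_. ?M))"
      using A unfolding ins uniform_points_def by (rule borel_measurable_indicator)
  qed auto
  also have "\<dots> \<le> (\<integral>\<^sup>+ x. ennreal ((2 * r) ^ CARD('d)) \<partial>PiM ?J (\<lambda>_. ?M))"
  proof (rule nn_integral_mono)
    fix x :: "nat \<Rightarrow> real ^ 'd"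
    have meas: "{y. norm (x i - y) \<le> r} \<in> sets borel" by measurable
    have "(\<integral>\<^sup>+ y. indicator ?A (x(j := y)) \<partial>?M) \<le> (\<integral>\<^sup>+ y. indicator {y. norm (x i - y) \<le> r} y \<partial>?M)"
      using assms by (intro nn_integral_mono) (auto simp: indicator_def)
    also have "\<dots> = emeasure ?M {y. norm (x i - y) \<le> r}"
      by (rule nn_integral_indicator) (use meas in simp)
    also have "\<dots> \<le> ennreal ((2 * r) ^ CARD('d))" by (rule inner)
    finally show "(\<integral>\<^sup>+ y. indicator ?A (x(j := y)) \<partial>?M) \<le> ennreal ((2 * r) ^ CARD('d))" .
  qed
  also have "\<dots> = ennreal ((2 * r) ^ CARD('d))"
  proof -
    have "emeasure (PiM ?J (\<lambda>_. ?M)) (space (PiM ?J (\<lambda>_. ?M))) = 1"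
      by (intro prob_space.emeasure_space_1 prob_space_PiM prob_space_unit_cube)
    then show ?thesis by (simp only: nn_integral_const mult_1_right)
  qed
  finally show ?thesis using assms(4) by (simp add: U.emeasure_eq_measure)
qed

text \<open>Markov's inequality for the number of edges. The expectation is bounded by a sum over
  ordered pairs; counting every edge twice costs only a constant.\<close>

lemma prob_many_edges_le:
  assumes "0 < t" "0 \<le> r"
  shows "\<P>(x in (uniform_points n :: (nat \<Rightarrow> real ^ 'd) measure). t \<le> real (card (geometric_edges n r x)))
    \<le> (real n)^2 * (2 * r) ^ CARD('d) / t"
proof -
  interpret U: prob_space "uniform_points n :: (nat \<Rightarrow> real ^ 'd) measure"
    by (rule prob_space_uniform_points)
  let ?U = "uniform_points n :: (nat \<Rightarrow> real ^ 'd) measure"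
  define P where "P = {(i, j). i \<in> {1..n} \<and> j \<in> {1..n} \<and> i \<noteq> j}"
  define A where "A = (\<lambda>(i, j). {x \<in> space ?U. norm (x i - x j) \<le> r})"
  have "P \<subseteq> {1..n} \<times> {1..n}" unfolding P_def by auto
  then have "finite P" by (rule finite_subset) simp
  have "card P \<le> card ({1..n} \<times> {1..n})" using \<open>P \<subseteq> _\<close> by (intro card_mono) auto
  then have card_P: "card P \<le> n^2" by (simp add: power2_eq_square)
  have A: "A p \<in> sets ?U" if "p \<in> P" for p
    using that unfolding A_def P_def by (cases p) (clarsimp, measurable)
  let ?E = "{x \<in> space ?U. t \<le> real (card (geometric_edges n r x))}"
  have E: "?E \<in> sets ?U" by (rule sets_uniform_points_edges)
  have "t * measure ?U ?E = (\<integral>x. t * indicator ?E x \<partial>?U)" using E by simp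
  also have "\<dots> \<le> (\<integral>x. (\<Sum>p\<in>P. indicator (A p) x) \<partial>?U)"
  proof (rule integral_mono)
    show "integrable ?U (\<lambda>x. t * indicator ?E x)"
      using E by (simp add: less_top[symmetric])
    show "integrable ?U (\<lambda>x. \<Sum>p\<in>P. indicator (A p) x :: real)"
      using A by (auto simp: less_top[symmetric])
    fix x assume x: "x \<in> space ?U"
    have "geometric_edges n r x = (\<lambda>(i, j). {i, j}) ` {p \<in> P. x \<in> A p}"
      using x unfolding geometric_edges_def P_def A_def by auto
    then have "card (geometric_edges n r x) \<le> card {p \<in> P. x \<in> A p}"
      using \<open>finite P\<close> by (simp add: card_image_le)
    moreover have "real (card {p \<in> P. x \<in> A p}) = (\<Sum>p\<in>P. indicator (A p) x)"
      using \<open>finite P\<close> by (simp add: indicator_def Int_def)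
    ultimately show "t * indicator ?E x \<le> (\<Sum>p\<in>P. indicator (A p) x :: real)"
      by (auto simp: indicator_def sum_nonneg split: if_splits)
  qed
  also have "\<dots> = (\<Sum>p\<in>P. measure ?U (A p))"
    using A by (simp add: less_top[symmetric])
  also have "\<dots> \<le> (\<Sum>p\<in>P. (2 * r) ^ CARD('d))"
    using prob_close_le[OF _ _ _ assms(2), where n = n and 'd = 'd]
    by (intro sum_mono) (auto simp: P_def A_def)
  also have "\<dots> = real (card P) * (2 * r) ^ CARD('d)" by simp
  also have "\<dots> \<le> real (n^2) * (2 * r) ^ CARD('d)"
    using card_P assms by (intro mult_right_mono of_nat_mono) auto
  finally show ?thesis using assms by (simp add: field_simps)
qed

section \<open>Cells of the cube\<close>

definition grid :: "nat \<Rightarrow> ('d::finite \<Rightarrow> nat) set" where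
  "grid m = {k. \<forall>i. k i < m}"

text \<open>Open boxes, so that different cells are disjoint and their measures add up. Points on
  the boundaries lie in no cell, but \<open>cell_index\<close> still assigns them a box.\<close>

definition cell :: "nat \<Rightarrow> ('d::finite \<Rightarrow> nat) \<Rightarrow> (real ^ 'd) set" where
  "cell m k = box (\<chi> i. real (k i) / real m) (\<chi> i. (real (k i) + 1) / real m)"

text \<open>The \<open>min\<close> moves points with a coordinate equal to 1 into the last layer.
  Thus every point receives an index, and the boxes of the deterministic argument cover all
  vertices.\<close>

definition cell_index :: "nat \<Rightarrow> real ^ 'd \<Rightarrow> ('d::finite \<Rightarrow> nat)" where
  "cell_index m x = (\<lambda>i. min (nat \<lfloor>real m * x $ i\<rfloor>) (m - 1))"

lemma grid_eq: "grid m = PiE UNIV (\<lambda>_. {..<m})"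
  by (auto simp: grid_def)

lemma finite_grid: "finite (grid m :: ('d::finite \<Rightarrow> nat) set)"
  unfolding grid_eq by (intro finite_PiE) auto

lemma card_grid: "card (grid m :: ('d::finite \<Rightarrow> nat) set) = m ^ CARD('d)"
  unfolding grid_eq by (simp add: card_PiE)

lemma cell_index_in_grid: "0 < m \<Longrightarrow> cell_index m x \<in> grid m"
  by (auto simp: grid_def cell_index_def)

lemma cell_index_cell:
  assumes "0 < m" "k \<in> grid m" "x \<in> cell m k"
  shows "cell_index m x = k"
proof
  fix i
  have "real (k i) / real m < x $ i" "x $ i < (real (k i) + 1) / real m"
    using assms(3) by (auto simp: cell_def mem_box_cart)
  then have "real (k i) < real m * x $ i" "real m * x $ i < real (k i) + 1"
    using assms(1) by (auto simp: field_simps)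
  then have "\<lfloor>real m * x $ i\<rfloor> = int (k i)" by linarith
  moreover have "k i < m" using assms(2) by (auto simp: grid_def)
  ultimately show "cell_index m x i = k i" by (simp add: cell_index_def)
qed

lemma cell_index_bounds:
  assumes "0 < m" "x \<in> cbox 0 1"
  shows "real (cell_index m x i) \<le> real m * x $ i" "real m * x $ i \<le> real (cell_index m x i) + 1"
proof -
  have x: "0 \<le> x $ i" "x $ i \<le> 1" using assms(2) by (auto simp: mem_box_cart)
  then have nn: "0 \<le> real m * x $ i" and le: "real m * x $ i \<le> real m"
    using assms(1) mult_left_mono[of "x $ i" 1 "real m"] by auto
  have "real (nat \<lfloor>real m * x $ i\<rfloor>) \<le> real m * x $ i" using nn by linarith
  then show "real (cell_index m x i) \<le> real m * x $ i" by (simp add: cell_index_def min_def)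
  have "real m * x $ i \<le> real (nat \<lfloor>real m * x $ i\<rfloor>) + 1" using nn by linarith
  \<comment> \<open>The clamped case: at \<open>x $ i = 1\<close> the index is \<open>m - 1\<close>
    and the upper bound is attained, hence not strict.\<close>
  moreover have "real m * x $ i \<le> real (m - 1) + 1" using le assms(1) by simp
  ultimately show "real m * x $ i \<le> real (cell_index m x i) + 1"
    by (simp add: cell_index_def min_def)
qed

text \<open>The l1 norm dominates the Euclidean one. Compared with the true diameter this loses a
  factor depending on the dimension, which the assumption on the radius absorbs.\<close>

lemma norm_le_if_same_cell:
  fixes x y :: "real ^ 'd"
  assumes "0 < m" "x \<in> cbox 0 1" "y \<in> cbox 0 1" "cell_index m x = cell_index m y"
  shows "norm (x - y) \<le> real CARD('d) / real m"
proof -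
  have "\<bar>(x - y) $ i\<bar> \<le> 1 / real m" for i
  proof -
    have "\<bar>real m * x $ i - real m * y $ i\<bar> \<le> 1"
      using cell_index_bounds[OF assms(1,2), of i] cell_index_bounds[OF assms(1,3), of i]
      unfolding assms(4) by linarith
    then have "real m * \<bar>x $ i - y $ i\<bar> \<le> 1"
      using assms(1) by (simp add: abs_mult flip: right_diff_distrib)
    then show ?thesis using assms(1) by (simp add: field_simps)
  qed
  then have "(\<Sum>i\<in>UNIV. \<bar>(x - y) $ i\<bar>) \<le> (\<Sum>i\<in>(UNIV :: 'd set). 1 / real m)"
    by (intro sum_mono)
  then show ?thesis using norm_le_l1_cart[of "x - y"] by simp
qed

lemma measure_cell: "0 < m \<Longrightarrow> measure lborel (cell m k :: (real ^ 'd) set) = (1 / real m) ^ CARD('d)"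
proof -
  assume m: "0 < m"
  let ?l = "\<chi> i. real (k i) / real m" and ?u = "\<chi> i. (real (k i) + 1) / real m"
  have l: "?l \<bullet> b \<le> ?u \<bullet> b" and d: "(?u - ?l) \<bullet> b = 1 / real m"
    if "b \<in> Basis" for b :: "real ^ 'd"
    using that m by (auto simp: Basis_vec_def inner_axis divide_right_mono field_simps)
  have "(\<Prod>b\<in>(Basis :: (real ^ 'd) set). (?u - ?l) \<bullet> b) = (1 / real m) ^ CARD('d)" using d by simp
  then have "emeasure lborel (cell m k :: (real ^ 'd) set) = ennreal ((1 / real m) ^ CARD('d))"
    unfolding cell_def using l by (simp only: emeasure_lborel_box)
  then show ?thesis by (simp add: measure_def)
qed

lemma cell_subset_cube:
  assumes "0 < m" "k \<in> grid m"
  shows "cell m k \<subseteq> cbox 0 1"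
proof
  fix x assume x: "x \<in> cell m k"
  have "0 \<le> x $ i \<and> x $ i \<le> 1" for i
  proof
    have b: "real (k i) / real m < x $ i" "x $ i < (real (k i) + 1) / real m"
      using x by (auto simp: cell_def mem_box_cart)
    have "0 \<le> real (k i) / real m" by simp
    with b show "0 \<le> x $ i" by linarith
    have "k i < m" using assms(2) by (simp add: grid_def)
    then have "(real (k i) + 1) / real m \<le> 1" using assms(1) by simp
    with b show "x $ i \<le> 1" by linarith
  qed
  then show "x \<in> cbox 0 1" by (simp add: mem_box_cart)
qed

lemma open_cell: "open (cell m k)"
  by (simp add: cell_def open_box)

lemma measure_cells:
  assumes "0 < m" "S \<subseteq> grid m"
  shows "measure (uniform_measure lborel (cbox 0 1)) (\<Union>k\<in>S. cell m k :: (real ^ 'd) set)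
    = real (card S) / real (m ^ CARD('d))"
proof -
  have "finite S" using assms(2) finite_grid by (rule finite_subset)
  have "disjoint_family_on (cell m :: _ \<Rightarrow> (real ^ 'd) set) S"
    unfolding disjoint_family_on_def
  proof (intro ballI impI)
    fix k l :: "'d \<Rightarrow> nat" assume "k \<in> S" "l \<in> S" "k \<noteq> l"
    then show "cell m k \<inter> cell m l = {}"
      using assms cell_index_cell[of m k] cell_index_cell[of m l] by blast
  qed
  have "measure (uniform_measure lborel (cbox 0 1)) (\<Union>k\<in>S. cell m k :: (real ^ 'd) set)
      = measure lborel (cbox 0 1 \<inter> (\<Union>k\<in>S. cell m k) :: (real ^ 'd) set)"
    by (intro measure_unit_cube borel_open open_UN ballI open_cell)
  also have "cbox 0 1 \<inter> (\<Union>k\<in>S. cell m k) = (\<Union>k\<in>S. cell m k :: (real ^ 'd) set)"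
    using assms cell_subset_cube by blast
  also have "measure lborel (\<Union>k\<in>S. cell m k :: (real ^ 'd) set) = (\<Sum>k\<in>S. measure lborel (cell m k :: (real ^ 'd) set))"
  proof (rule measure_finite_Union)
    show "emeasure lborel (cell m k :: (real ^ 'd) set) \<noteq> \<infinity>" for k
      using emeasure_lborel_box_finite[where 'a = "real ^ 'd"] by (simp add: cell_def less_top)
    show "cell m ` S \<subseteq> sets (lborel :: (real ^ 'd) measure)"
      using borel_open[OF open_cell] by auto
  qed fact+
  also have "\<dots> = real (card S) / real (m ^ CARD('d))"
    using assms(1) by (simp add: measure_cell power_one_over)
  finally show ?thesis .
qed

section \<open>Probability of a clique tiling at a fixed radius\<close>

lemma degree_eq_card_neighbours:
  assumes "simple_graph V E" "v \<in> V"
  shows "degree E v = card {w \<in> V. {v, w} \<in> E}"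
proof -
  have "{e \<in> E. v \<in> e} = (\<lambda>w. {v, w}) ` {w \<in> V. {v, w} \<in> E}"
  proof (intro set_eqI iffI)
    fix e assume e: "e \<in> {e \<in> E. v \<in> e}"
    then have "e \<in> nsets V 2" using assms by (auto simp: simple_graph_def)
    then obtain x y where "e = {x, y}" "x \<in> V" "y \<in> V" "x \<noteq> y" by (rule nsets2_E)
    with e show "e \<in> (\<lambda>w. {v, w}) ` {w \<in> V. {v, w} \<in> E}"
      by (cases "v = x") (auto simp: insert_commute)
  qed auto
  moreover have "inj_on (\<lambda>w. {v, w}) {w \<in> V. {v, w} \<in> E}"
    by (auto simp: inj_on_def doubleton_eq_iff)
  ultimately show ?thesis by (simp add: degree_def card_image)
qed

text \<open>If more than \<open>M / (2 * f)\<close> cells were poor for v, then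
  \<open>M div (2 * f) + 1\<close> of them would together contain too few neighbours of v. The
  hypothesis counts neighbours in E alone, a set that is fixed before the points are drawn, so that
  the number of them in a union of cells is a sum of independent indicators.\<close>

lemma clique_tiling_if_cells_populated:
  fixes x :: "nat \<Rightarrow> real ^ 'd" and m :: nat
  defines "M \<equiv> card (grid m :: ('d \<Rightarrow> nat) set)"
  assumes "0 < f" "f dvd n" "0 < m" "real CARD('d) / real m \<le> r"
    and cube: "\<And>i. i \<in> {1..n} \<Longrightarrow> x i \<in> cbox 0 1"
    and populated: "\<And>v S. v \<in> {1..n} \<Longrightarrow> S \<subseteq> grid m \<Longrightarrow> card S = M div (2 * f) + 1 \<Longrightarrow>
      (2 * f^2 + f) * card S < card {w \<in> {w \<in> {1..n}. {v, w} \<in> E}. x w \<in> (\<Union>k\<in>S. cell m k)}"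
  shows "clique_tiling f (E \<union> geometric_edges n r x) {1..n}"
proof (rule clique_tiling_of_boxes[where box = "\<lambda>v. cell_index m (x v)" and B = "grid m"])
  fix v w assume vw: "v \<in> {1..n}" "w \<in> {1..n}" "cell_index m (x v) = cell_index m (x w)" "v \<noteq> w"
  then have "norm (x v - x w) \<le> r"
    using norm_le_if_same_cell[OF \<open>0 < m\<close> cube[of v] cube[of w]] assms(5) by linarith
  then show "{v, w} \<in> E \<union> geometric_edges n r x"
    using doubleton_in_geometric_edges vw by blast
next
  fix v assume v: "v \<in> {1..n}"
  define s where "s = 2 * f^2 + f"
  define N where "N = (\<lambda>b. {w \<in> {1..n}. cell_index m (x w) = b \<and> {v, w} \<in> E \<union> geometric_edges n r x})"
  let ?Q = "{b \<in> grid m. card (N b) < s}"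
  have "2 * f * card ?Q \<le> M"
  proof (rule ccontr)
    assume "\<not> ?thesis"
    then have "M div (2 * f) + 1 \<le> card ?Q"
      using \<open>0 < f\<close> by (simp add: div_less_iff_less_mult mult.commute Suc_le_eq)
    then obtain S where S: "S \<subseteq> ?Q" "card S = M div (2 * f) + 1" "finite S"
      by (rule obtain_subset_with_card_n)
    have "{w \<in> {w \<in> {1..n}. {v, w} \<in> E}. x w \<in> (\<Union>k\<in>S. cell m k)} \<subseteq> (\<Union>b\<in>S. N b)"
    proof
      fix w assume w: "w \<in> {w \<in> {w \<in> {1..n}. {v, w} \<in> E}. x w \<in> (\<Union>k\<in>S. cell m k)}"
      then obtain k where k: "k \<in> S" "x w \<in> cell m k" by blast
      then have "cell_index m (x w) = k" using S \<open>0 < m\<close> by (intro cell_index_cell) auto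
      then show "w \<in> (\<Union>b\<in>S. N b)" using w k unfolding N_def by blast
    qed
    then have "card {w \<in> {w \<in> {1..n}. {v, w} \<in> E}. x w \<in> (\<Union>k\<in>S. cell m k)} \<le> card (\<Union>b\<in>S. N b)"
      using S by (intro card_mono) (auto simp: N_def)
    also have "\<dots> \<le> (\<Sum>b\<in>S. card (N b))" using S(3) by (rule card_UN_le)
    also have "\<dots> \<le> (\<Sum>b\<in>S. s)" using S by (intro sum_mono) auto
    also have "\<dots> = s * card S" by simp
    finally show False using populated[OF v _ S(2)] S(1) unfolding s_def by fastforce
  qed
  then show "2 * f * card {b \<in> grid m. card {w \<in> {1..n}. cell_index m (x w) = b \<and>
      {v, w} \<in> E \<union> geometric_edges n r x} < 2 * f^2 + f} \<le> card (grid m :: ('d \<Rightarrow> nat) set)"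
    unfolding s_def N_def M_def .
next
  show "cell_index m (x v) \<in> grid m" for v using \<open>0 < m\<close> by (rule cell_index_in_grid)
qed (simp_all add: \<open>0 < f\<close> \<open>f dvd n\<close> finite_grid)

text \<open>Union bound over a vertex v and a set S of q cells. The cells in S have total measure at
  least \<open>1 / (2 * f)\<close> and v has at least \<alpha> n neighbours, so each pair fails with
  probability at most \<open>2 ^ (s * q)\<close> times a power of \<open>1 - 1 / (4 * f)\<close>.
  Bounding q by M and the number of sets S by \<open>2 ^ M\<close> merges the powers of 2 into the
  exponent \<open>(s + 1) * M\<close>.\<close>

lemma prob_clique_tiling_ge:
  assumes "0 < f" "f dvd n" "0 < m" "real CARD('d) / real m \<le> r" "simple_graph {1..n} E"
    and deg: "\<And>v. v \<in> {1..n} \<Longrightarrow> \<alpha> * real n \<le> real (degree E v)"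
  shows "1 - real n * 2 ^ ((2 * f^2 + f + 1) * m ^ CARD('d)) * exp (- (\<alpha> * real n) / (4 * real f))
    \<le> perturbed_prob TYPE('d::finite) (\<lambda>V E. clique_tiling f E V) E n r"
proof -
  let ?U = "uniform_points n :: (nat \<Rightarrow> real ^ 'd) measure"
  let ?C = "uniform_measure lborel (cbox 0 1 :: (real ^ 'd) set)"
  interpret U: prob_space ?U by (rule prob_space_uniform_points)
  interpret C: prob_space ?C by (rule prob_space_unit_cube)
  define M where "M = m ^ CARD('d)"
  define q where "q = M div (2 * f) + 1"
  define s where "s = 2 * f^2 + f"
  have "0 < M" using assms(3) by (simp add: M_def)
  have "q \<le> M" using \<open>0 < M\<close> \<open>0 < f\<close> by (simp add: q_def Suc_le_eq div_less_dividend)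
  have q_ge: "1 / (2 * real f) \<le> real q / real M"
  proof -
    have "M < q * (2 * f)"
      unfolding q_def using \<open>0 < f\<close> by (metis Suc_eq_plus1 dividend_less_times_div mult.commute mult_pos_pos mult_Suc_right zero_less_numeral)
    then have "real M \<le> real q * (2 * real f)" by (metis less_imp_le of_nat_le_iff of_nat_mult of_nat_numeral)
    then show ?thesis using \<open>0 < M\<close> \<open>0 < f\<close> by (simp add: field_simps)
  qed
  define Ss where "Ss = {S :: ('d \<Rightarrow> nat) set. S \<subseteq> grid m \<and> card S = q}"
  define N where "N = (\<lambda>v. {w \<in> {1..n}. {v, w} \<in> E})"
  define A where "A = (\<lambda>(v, S). {x \<in> space ?U. card {w \<in> N v. x w \<in> (\<Union>k\<in>S. cell m k)} \<le> s * q})"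
  have "Ss \<subseteq> Pow (grid m)" by (auto simp: Ss_def)
  then have "finite Ss" using finite_grid by (meson finite_Pow_iff finite_subset)
  have "card Ss \<le> 2 ^ M"
    using card_mono[OF _ \<open>Ss \<subseteq> Pow (grid m)\<close>] finite_grid[where 'd = 'd, of m]
    by (simp add: card_Pow card_grid M_def)
  have cells: "(\<Union>k\<in>S. cell m k :: (real ^ 'd) set) \<in> sets ?C" for S
  proof -
    have "open (\<Union>k\<in>S. cell m k :: (real ^ 'd) set)" by (intro open_UN ballI open_cell)
    then show ?thesis by simp
  qed
  have N_subset: "N v \<subseteq> {1..n}" for v by (auto simp: N_def)
  have A_sets: "A p \<in> sets ?U" for p
    unfolding A_def uniform_points_def case_prod_beta
    by (rule sets_few_points[OF finite_atLeastAtMost N_subset cells])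
  have A_prob: "measure ?U (A p) \<le> 2 ^ (s * M) * exp (- (\<alpha> * real n) / (4 * real f))"
    if p_in: "p \<in> {1..n} \<times> Ss" for p
  proof -
    obtain v S where p: "p = (v, S)" "v \<in> {1..n}" "S \<subseteq> grid m" "card S = q"
      using p_in by (auto simp: Ss_def)
    have "measure ?C (\<Union>k\<in>S. cell m k :: (real ^ 'd) set) = real q / real M"
      using measure_cells[OF assms(3) p(3)] p(4) by (simp add: M_def)
    then have meas: "1 / (2 * real f) \<le> measure ?C (\<Union>k\<in>S. cell m k)" using q_ge by simp
    have le1: "measure ?C (\<Union>k\<in>S. cell m k) \<le> 1" by (rule C.prob_le_1)
    have "measure ?U (A p) \<le> 2 ^ (s * q) * (1 - measure ?C (\<Union>k\<in>S. cell m k) / 2) ^ card (N v)"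
      unfolding A_def p(1) uniform_points_def prod.case
      by (rule prob_few_points_le[OF prob_space_unit_cube finite_atLeastAtMost N_subset cells])
    also have "\<dots> \<le> 2 ^ (s * M) * exp (- (\<alpha> * real n) / (4 * real f))"
    proof (rule mult_mono)
      show "(2 :: real) ^ (s * q) \<le> 2 ^ (s * M)" using \<open>q \<le> M\<close> by (intro power_increasing) auto
      have "(1 - measure ?C (\<Union>k\<in>S. cell m k) / 2) ^ card (N v) \<le> exp (- 1 / (4 * real f)) ^ card (N v)"
      proof (rule power_mono)
        have "1 - measure ?C (\<Union>k\<in>S. cell m k) / 2 \<le> 1 + (- 1 / (4 * real f))"
          using meas by (simp add: field_simps)
        also have "\<dots> \<le> exp (- 1 / (4 * real f))" by (rule exp_ge_add_one_self)
        finally show "1 - measure ?C (\<Union>k\<in>S. cell m k) / 2 \<le> exp (- 1 / (4 * real f))" .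
        show "0 \<le> 1 - measure ?C (\<Union>k\<in>S. cell m k) / 2"
          using le1 by linarith
      qed
      also have "\<dots> = exp (- real (card (N v)) / (4 * real f))"
        by (simp flip: exp_of_nat_mult)
      also have "\<dots> \<le> exp (- (\<alpha> * real n) / (4 * real f))"
      proof -
        have "\<alpha> * real n \<le> real (card (N v))"
          using deg[OF p(2)] degree_eq_card_neighbours[OF assms(5) p(2)] by (simp add: N_def)
        then show ?thesis by (simp add: divide_right_mono)
      qed
      finally show "(1 - measure ?C (\<Union>k\<in>S. cell m k) / 2) ^ card (N v) \<le> exp (- (\<alpha> * real n) / (4 * real f))" .
      show "0 \<le> (1 - measure ?C (\<Union>k\<in>S. cell m k) / 2) ^ card (N v)"
        using le1 by (intro zero_le_power) linarith
    qed simp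
    finally show ?thesis .
  qed
  let ?T = "{x \<in> space ?U. clique_tiling f (E \<union> geometric_edges n r x) {1..n}}"
  have T: "?T \<in> sets ?U" by (rule sets_uniform_points_edges)
  have "1 - measure ?U ?T = measure ?U (space ?U - ?T)" using T by (simp add: U.prob_compl)
  also have "\<dots> \<le> measure ?U (\<Union>p\<in>{1..n} \<times> Ss. A p)"
  \<comment> \<open>The inclusion of events holds only almost surely, since the deterministic
    criterion requires all points to lie in the cube.\<close>
  proof (rule U.finite_measure_mono_AE)
    show "AE x in ?U. x \<in> space ?U - ?T \<longrightarrow> x \<in> (\<Union>p\<in>{1..n} \<times> Ss. A p)"
      using AE_uniform_points_in_cube[of n] AE_space
    proof eventually_elim
      case (elim x)
      show ?case
      proof (rule impI, rule ccontr)
        assume x: "x \<in> space ?U - ?T" and nA: "x \<notin> (\<Union>p\<in>{1..n} \<times> Ss. A p)"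
        have "clique_tiling f (E \<union> geometric_edges n r x) {1..n}"
        proof (rule clique_tiling_if_cells_populated[OF assms(1-4)])
          show "x i \<in> cbox 0 1" if "i \<in> {1..n}" for i using elim that by blast
          fix v :: nat and S :: "('d \<Rightarrow> nat) set"
          assume vS: "v \<in> {1..n}" "S \<subseteq> grid m" "card S = card (grid m :: ('d \<Rightarrow> nat) set) div (2 * f) + 1"
          then have "card S = q" by (simp add: card_grid q_def M_def)
          then have "x \<notin> A (v, S)" using nA vS by (auto simp: Ss_def)
          then show "(2 * f^2 + f) * card S < card {w \<in> {w \<in> {1..n}. {v, w} \<in> E}. x w \<in> (\<Union>k\<in>S. cell m k)}"
            using elim \<open>card S = q\<close> unfolding A_def N_def s_def by simp
        qed
        then show False using x by blast
      qed
    qed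
    show "(\<Union>p\<in>{1..n} \<times> Ss. A p) \<in> sets ?U" using \<open>finite Ss\<close> A_sets by auto
  qed
  also have "\<dots> \<le> (\<Sum>p\<in>{1..n} \<times> Ss. measure ?U (A p))"
    using \<open>finite Ss\<close> A_sets by (intro U.finite_measure_subadditive_finite) auto
  also have "\<dots> \<le> (\<Sum>p\<in>{1..n} \<times> Ss. 2 ^ (s * M) * exp (- (\<alpha> * real n) / (4 * real f)))"
    using A_prob by (intro sum_mono)
  also have "\<dots> = real n * real (card Ss) * (2 ^ (s * M) * exp (- (\<alpha> * real n) / (4 * real f)))"
    by (simp add: card_cartesian_product)
  also have "\<dots> \<le> real n * 2 ^ M * (2 ^ (s * M) * exp (- (\<alpha> * real n) / (4 * real f)))"
  proof -
    have "real (card Ss) \<le> 2 ^ M" using \<open>card Ss \<le> 2 ^ M\<close> by simp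
    then show ?thesis by (intro mult_right_mono mult_left_mono) auto
  qed
  also have "\<dots> = real n * 2 ^ ((s + 1) * M) * exp (- (\<alpha> * real n) / (4 * real f))"
    by (simp add: power_add mult_ac)
  finally show ?thesis unfolding perturbed_prob_def s_def M_def by simp
qed

section \<open>Above the threshold\<close>

lemma degree_ge_min_degree:
  assumes "finite V" "v \<in> V"
  shows "min_degree V E \<le> degree E v"
  unfolding min_degree_def using assms by (intro Min_le) auto

lemma perturbed_prob_has_factor_ge:
  assumes "simple_graph VF EF" "VF \<noteq> {}"
  shows "perturbed_prob TYPE('d::finite) (\<lambda>V E. clique_tiling (card VF) E V) E n r
    \<le> perturbed_prob TYPE('d) (has_factor VF EF) E n r"
proof -
  interpret U: prob_space "uniform_points n :: (nat \<Rightarrow> real ^ 'd) measure"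
    by (rule prob_space_uniform_points)
  show ?thesis
    unfolding perturbed_prob_def
  proof (rule U.finite_measure_mono)
    show "{x \<in> space (uniform_points n :: (nat \<Rightarrow> real ^ 'd) measure).
        clique_tiling (card VF) (E \<union> geometric_edges n r x) {1..n}}
      \<subseteq> {x \<in> space (uniform_points n). has_factor VF EF {1..n} (E \<union> geometric_edges n r x)}"
      using has_factor_if_clique_tiling[OF assms] by blast
  qed (rule sets_uniform_points_edges)
qed

text \<open>Take the integer part of (n / K)^(1/d). As K is at most n, the number rounded is at
  least 1, so rounding loses at most a factor 2 and the cell diameter stays within a constant of
  n^(-1/d).\<close>

lemma grid_size_exists:
  fixes K :: real and n d :: nat
  assumes "0 < K" "K \<le> real n" "0 < d"
  obtains m :: nat where "0 < m" "real (m ^ d) \<le> real n / K"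
    "real d / real m \<le> 2 * real d * K powr (1 / real d) * real n powr (- 1 / real d)"
proof -
  define y where "y = (real n / K) powr (1 / real d)"
  have n: "0 < real n" using assms by linarith
  have y1: "1 \<le> y" unfolding y_def using assms by (intro ge_one_powr_ge_zero) auto
  define m where "m = nat \<lfloor>y\<rfloor>"
  have "1 \<le> \<lfloor>y\<rfloor>" using y1 by (simp add: le_floor_iff)
  then have "0 < m" by (simp add: m_def)
  have m_le: "real m \<le> y" using y1 unfolding m_def by linarith
  have "y < real m + 1" using y1 unfolding m_def by linarith
  then have y_le: "y \<le> 2 * real m" using \<open>0 < m\<close> by linarith
  have "real (m ^ d) \<le> y ^ d" using m_le by (simp add: power_mono)
  also have "\<dots> = real n / K"
    using assms n by (simp add: y_def powr_powr flip: powr_realpow)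
  finally have "real (m ^ d) \<le> real n / K" .
  moreover have "real d / real m \<le> 2 * real d / y"
    using mult_left_mono[OF y_le, of "real d"] y1 \<open>0 < m\<close> by (simp add: field_simps)
  moreover have "2 * real d / y = 2 * real d * K powr (1 / real d) * real n powr (- 1 / real d)"
    using assms n by (simp add: y_def powr_divide powr_minus_divide)
  ultimately show ?thesis using that \<open>0 < m\<close> by simp
qed

lemma perturbed_prob_tendsto_1:
  assumes F: "simple_graph VF EF" "VF \<noteq> {}" and "0 < \<alpha>"
    and H: "min_degree_sequence {n. 0 < n \<and> card VF dvd n} \<alpha> H"
    and r: "\<forall>n\<in>{n. 0 < n \<and> card VF dvd n}. 0 \<le> r n"
      "r \<in> \<omega>[inf sequentially (principal {n. 0 < n \<and> card VF dvd n})](\<lambda>n. real n powr (- 1 / real CARD('d)))"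
  shows "((\<lambda>n. perturbed_prob TYPE('d::finite) (has_factor VF EF) (H n) n (r n)) \<longlongrightarrow> 1)
    (inf sequentially (principal {n. 0 < n \<and> card VF dvd n}))"
proof (rule tendsto_sandwich)
  let ?N = "{n. 0 < n \<and> card VF dvd n}"
  let ?F = "inf sequentially (principal ?N)"
  define f where "f = card VF"
  have "0 < f" using F by (simp add: f_def simple_graph_def card_gt_0_iff)
  define s where "s = 2 * f^2 + f + 1"
  \<comment> \<open>Chosen so that \<open>s * M\<close> is at most
    \<open>s * n / K = \<alpha> * n / (8 * f)\<close>, half of the exponent
    \<open>\<alpha> * n / (4 * f)\<close> in the failure bound. The other half is
    \<open>c * n\<close>. The final summand 1 in s accounts for the \<open>2 ^ M\<close> sets of
    cells.\<close>
  define K where "K = 8 * real f * real s / \<alpha>"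
  have "0 < s" by (simp add: s_def)
  then have "0 < K" using \<open>0 < f\<close> \<open>0 < \<alpha>\<close> by (simp add: K_def)
  define c where "c = \<alpha> / (8 * real f)"
  have "0 < c" using \<open>0 < f\<close> \<open>0 < \<alpha>\<close> by (simp add: c_def)
  have in_N: "eventually (\<lambda>n. n \<in> ?N) ?F"
    unfolding eventually_inf_principal by simp
  have large: "eventually (\<lambda>n. K \<le> real n) ?F"
    using filter_leD[OF inf_le1 eventually_ge_at_top[of "nat \<lceil>K\<rceil>"]]
    by (rule eventually_mono) linarith
  \<comment> \<open>The growth of r is used once, with the constant from
    \<open>grid_size_exists\<close>: eventually the cells have diameter at most
    \<open>r n\<close>.\<close>
  have radius: "eventually (\<lambda>n. norm (r n) \<ge>
      (2 * real CARD('d) * K powr (1 / real CARD('d))) * norm (real n powr (- 1 / real CARD('d)))) ?F"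
    using r(2) by (rule landau_omega.smallD)
      (use \<open>0 < K\<close> in simp)
  show "eventually (\<lambda>n. 1 - real n * exp (- c * real n)
      \<le> perturbed_prob TYPE('d) (has_factor VF EF) (H n) n (r n)) ?F"
    using in_N large radius
  proof eventually_elim
    case (elim n)
    then have n: "0 < n" "f dvd n" by (auto simp: f_def)
    obtain m where m: "0 < m" "real (m ^ CARD('d)) \<le> real n / K"
      "real CARD('d) / real m
        \<le> 2 * real CARD('d) * K powr (1 / real CARD('d)) * real n powr (- 1 / real CARD('d))"
      using grid_size_exists[OF \<open>0 < K\<close> elim(2), of "CARD('d)"] by auto
    have "0 \<le> r n" using r(1) elim(1) by blast
    then have rn: "real CARD('d) / real m \<le> r n" using m(3) elim(3) by simp
    have sg: "simple_graph {1..n} (H n)" and md: "\<alpha> * real n \<le> real (min_degree {1..n} (H n))"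
      using H elim(1) unfolding min_degree_sequence_def by blast+
    have deg: "\<alpha> * real n \<le> real (degree (H n) v)" if "v \<in> {1..n}" for v
      using degree_ge_min_degree[OF _ that, of "H n"] md by simp
    have "(2 :: real) ^ (s * m ^ CARD('d)) \<le> exp 1 ^ (s * m ^ CARD('d))"
      using exp_ge_add_one_self[of 1] by (intro power_mono) auto
    also have "\<dots> = exp (real s * real (m ^ CARD('d)))" by (simp flip: exp_of_nat_mult)
    also have "\<dots> \<le> exp (real s * (real n / K))" using m(2) by (simp only: exp_le_cancel_iff mult_left_mono of_nat_0_le_iff)
    also have "real s * (real n / K) = c * real n"
      using \<open>0 < f\<close> \<open>0 < \<alpha>\<close> \<open>0 < s\<close> by (simp add: K_def c_def)
    finally have "real n * 2 ^ (s * m ^ CARD('d)) * exp (- (\<alpha> * real n) / (4 * real f))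
        \<le> real n * exp (c * real n) * exp (- (\<alpha> * real n) / (4 * real f))"
      by (intro mult_right_mono mult_left_mono) auto
    also have "\<dots> = real n * exp (- c * real n)"
    proof -
      have "c * real n + - (\<alpha> * real n) / (4 * real f) = - c * real n"
        using \<open>0 < f\<close> by (simp add: c_def field_simps)
      then show ?thesis by (simp only: mult.assoc flip: exp_add)
    qed
    finally have "1 - real n * exp (- c * real n)
        \<le> perturbed_prob TYPE('d) (\<lambda>V E. clique_tiling f E V) (H n) n (r n)"
      using prob_clique_tiling_ge[OF \<open>0 < f\<close> n(2) m(1) rn sg deg]
      unfolding s_def by fastforce
    then show ?case
      using perturbed_prob_has_factor_ge[OF F, of "H n" n "r n", where 'd = 'd] unfolding f_def
      by linarith
  qed
  show "eventually (\<lambda>n. perturbed_prob TYPE('d) (has_factor VF EF) (H n) n (r n) \<le> 1) ?F"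
    unfolding perturbed_prob_def
    by (intro always_eventually allI prob_space.prob_le_1 prob_space_uniform_points)
  have "(\<lambda>n::nat. 1 - real n * exp (- c * real n)) \<longlonglongrightarrow> 1" using \<open>0 < c\<close> by real_asymp
  then show "((\<lambda>n. 1 - real n * exp (- c * real n)) \<longlongrightarrow> 1) ?F"
    by (rule tendsto_mono[OF inf_le1])
qed (rule tendsto_const)

section \<open>Colour classes and factors of multipartite graphs\<close>

definition complete_multipartite :: "'b set \<Rightarrow> ('b \<Rightarrow> nat) \<Rightarrow> 'b set set" where
  "complete_multipartite V c = {e \<in> nsets V 2. inj_on c e}"

lemma doubleton_in_complete_multipartite:
  "{u, v} \<in> complete_multipartite V c \<longleftrightarrow> u \<in> V \<and> v \<in> V \<and> c u \<noteq> c v"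
  by (auto simp: complete_multipartite_def)

text \<open>An injective numbering of the vertices is proper, so the \<open>LEAST\<close> ranges
  over a nonempty set and is attained.\<close>

lemma proper_colouring_chromatic_number:
  assumes "simple_graph V E"
  shows "\<exists>c. proper_colouring V E (chromatic_number V E) c"
proof -
  have "finite V" "E \<subseteq> nsets V 2" using assms by (auto simp: simple_graph_def)
  from \<open>finite V\<close> obtain c :: "'a \<Rightarrow> nat" and n where c: "c ` V = {i. i < n}" "inj_on c V"
    using finite_imp_inj_to_nat_seg[OF \<open>finite V\<close>] by (elim exE conjE) (rule that)
  have "c u \<noteq> c v" if "u \<in> V" "v \<in> V" "{u, v} \<in> E" for u v
  proof -
    have "{u, v} \<in> nsets V 2" using that \<open>E \<subseteq> nsets V 2\<close> by blast
    then have "u \<noteq> v" by simp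
    then show ?thesis using c(2) that by (auto simp: inj_on_def)
  qed
  then have "proper_colouring V E n c" using c(1) by (auto simp: proper_colouring_def)
  then have "\<exists>k c. proper_colouring V E k c" by blast
  then show ?thesis unfolding chromatic_number_def by (rule LeastI_ex)
qed

text \<open>If colour i were missing, moving the top colour onto i would save one colour, against
  minimality.\<close>

lemma colour_class_nonempty:
  assumes c: "proper_colouring V E (chromatic_number V E) c" and i: "i < chromatic_number V E"
  shows "\<exists>v\<in>V. c v = i"
proof (rule ccontr)
  assume no: "\<not> ?thesis"
  let ?k = "chromatic_number V E"
  let ?c = "\<lambda>v. if c v = ?k - 1 then i else c v"
  have "proper_colouring V E (?k - 1) ?c"
    unfolding proper_colouring_def
  proof (intro conjI ballI impI)
    fix v assume v: "v \<in> V"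
    have "c v < ?k" using c v by (auto simp: proper_colouring_def)
    moreover have "c v \<noteq> i" using no v by blast
    ultimately show "?c v < ?k - 1" using i by auto
  next
    fix u v assume uv: "u \<in> V" "v \<in> V" "{u, v} \<in> E"
    then have "c u \<noteq> c v" using c by (auto simp: proper_colouring_def)
    moreover have "c u \<noteq> i" "c v \<noteq> i" using no uv by blast+
    ultimately show "?c u \<noteq> ?c v" by auto
  qed
  then have "?k \<le> ?k - 1" unfolding chromatic_number_def by (intro Least_le) blast
  then show False using i by simp
qed

lemma smallest_class_le:
  assumes "proper_colouring V E (chromatic_number V E) c" "i < chromatic_number V E"
  shows "smallest_class V E \<le> card {v \<in> V. c v = i}"
proof -
  have "smallest_class V E \<le> (MIN i\<in>{..<chromatic_number V E}. card {v \<in> V. c v = i})"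
    unfolding smallest_class_def using assms(1) by (intro cINF_lower) auto
  also have "\<dots> \<le> card {v \<in> V. c v = i}" using assms(2) by (intro Min_le) auto
  finally show ?thesis .
qed

lemma smallest_class_attained:
  assumes "simple_graph V E" "0 < chromatic_number V E"
  obtains c i where "proper_colouring V E (chromatic_number V E) c" "i < chromatic_number V E"
    "card {v \<in> V. c v = i} = smallest_class V E"
proof -
  let ?k = "chromatic_number V E"
  have "smallest_class V E \<in> (\<lambda>c. MIN i\<in>{..<?k}. card {v \<in> V. c v = i}) ` {c. proper_colouring V E ?k c}"
    unfolding smallest_class_def
    using proper_colouring_chromatic_number[OF assms(1)] by (intro Inf_nat_def1) auto
  then obtain c where c: "proper_colouring V E ?k c"
    "smallest_class V E = (MIN i\<in>{..<?k}. card {v \<in> V. c v = i})" by blast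
  have "(MIN i\<in>{..<?k}. card {v \<in> V. c v = i}) \<in> (\<lambda>i. card {v \<in> V. c v = i}) ` {..<?k}"
    using assms(2) by (intro Min_in) auto
  then show ?thesis using that c by auto
qed

lemma card_eq_sum_colour_classes:
  assumes "finite V" "proper_colouring V E k c"
  shows "card V = (\<Sum>i<k. card {v \<in> V. c v = i})"
proof -
  have "V = (\<Union>i<k. {v \<in> V. c v = i})" using assms(2) by (auto simp: proper_colouring_def)
  then have "card V = card (\<Union>i<k. {v \<in> V. c v = i})" by (rule arg_cong)
  also have "\<dots> = (\<Sum>i<k. card {v \<in> V. c v = i})"
    using assms(1) by (intro card_UN_disjoint) auto
  finally show ?thesis .
qed

text \<open>All three bounds are read off a colouring that attains the smallest class: its classes
  are nonempty, each has at least \<open>smallest_class V E\<close> vertices, and the classes other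
  than the smallest contribute at least one vertex each. The last two bounds later ensure that the
  extremal classes fit the degree condition.\<close>

lemma smallest_class_bounds:
  assumes "simple_graph V E" "0 < chromatic_number V E"
  shows "0 < smallest_class V E"
    and "chromatic_number V E * smallest_class V E \<le> card V"
    and "chromatic_number V E - 1 + smallest_class V E \<le> card V"
proof -
  let ?k = "chromatic_number V E"
  have "finite V" using assms(1) by (simp add: simple_graph_def)
  obtain c i where c: "proper_colouring V E ?k c" "i < ?k" "card {v \<in> V. c v = i} = smallest_class V E"
    using smallest_class_attained[OF assms] .
  have pos: "0 < card {v \<in> V. c v = j}" if "j < ?k" for j
    using colour_class_nonempty[OF c(1) that] \<open>finite V\<close> by (auto simp: card_gt_0_iff)
  show "0 < smallest_class V E" using pos[OF c(2)] c(3) by simp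
  have card_V: "card V = (\<Sum>j<?k. card {v \<in> V. c v = j})"
    using \<open>finite V\<close> c(1) by (rule card_eq_sum_colour_classes)
  have "(\<Sum>j<?k. smallest_class V E) \<le> (\<Sum>j<?k. card {v \<in> V. c v = j})"
    using smallest_class_le[OF c(1)] by (intro sum_mono) auto
  then show "?k * smallest_class V E \<le> card V" using card_V by simp
  have "(\<Sum>j\<in>{..<?k} - {i}. 1) \<le> (\<Sum>j\<in>{..<?k} - {i}. card {v \<in> V. c v = j})"
    using pos by (intro sum_mono) (auto simp: Suc_le_eq)
  moreover have "card V = card {v \<in> V. c v = i} + (\<Sum>j\<in>{..<?k} - {i}. card {v \<in> V. c v = j})"
    unfolding card_V using c(2) by (intro sum.remove) auto
  ultimately show "?k - 1 + smallest_class V E \<le> card V" using c(2,3) by simp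
qed

section \<open>Complete multipartite graphs with few additional edges\<close>

lemma min_degree_complete_multipartite_ge:
  assumes "finite V" "V \<noteq> {}"
    and classes: "\<And>v. v \<in> V \<Longrightarrow> real (card {w \<in> V. c w = c v}) \<le> (1 - \<alpha>) * real (card V)"
  shows "simple_graph V (complete_multipartite V c)"
    and "\<alpha> * real (card V) \<le> real (min_degree V (complete_multipartite V c))"
proof -
  show sg: "simple_graph V (complete_multipartite V c)"
    using assms(1) by (auto simp: simple_graph_def complete_multipartite_def)
  have "min_degree V (complete_multipartite V c) \<in> degree (complete_multipartite V c) ` V"
    unfolding min_degree_def using assms by (intro Min_in) auto
  then obtain v where v: "v \<in> V" "min_degree V (complete_multipartite V c) = degree (complete_multipartite V c) v"
    by blast
  have "degree (complete_multipartite V c) v = card {w \<in> V. {v, w} \<in> complete_multipartite V c}"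
    using sg v(1) by (rule degree_eq_card_neighbours)
  also have "{w \<in> V. {v, w} \<in> complete_multipartite V c} = V - {w \<in> V. c w = c v}"
    using v(1) by (auto simp: doubleton_in_complete_multipartite)
  also have "card \<dots> = card V - card {w \<in> V. c w = c v}"
    using assms(1) by (intro card_Diff_subset) auto
  finally have "real (card V) - real (card {w \<in> V. c w = c v})
      \<le> real (degree (complete_multipartite V c) v)"
    by linarith
  then show "\<alpha> * real (card V) \<le> real (min_degree V (complete_multipartite V c))"
    using classes[OF v(1)] v(2) by (simp add: algebra_simps)
qed

text \<open>A copy of \<open>F\<close> inside the multipartite graph inherits a proper colouring, so it meets every
  colour class in at least \<open>smallest_class VF EF\<close> vertices; every other copy contains its own edge of \<open>G\<close>.\<close>

lemma factor_of_multipartite_Un: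
  fixes c :: "'b \<Rightarrow> nat"
  assumes F: "simple_graph VF EF" "VF \<noteq> {}" and "finite V" "finite G"
    and factor: "has_factor VF EF V (complete_multipartite V c \<union> G)"
    and c: "\<And>v. v \<in> V \<Longrightarrow> c v < chromatic_number VF EF" and i: "i < chromatic_number VF EF"
  shows "smallest_class VF EF * card V
    \<le> card VF * (card {v \<in> V. c v = i} + smallest_class VF EF * card G)"
proof -
  let ?K = "complete_multipartite V c" and ?s = "smallest_class VF EF"
  have "finite VF" and EF: "EF \<subseteq> nsets VF 2" using F by (auto simp: simple_graph_def)
  obtain C where C: "\<forall>(W, D)\<in>C. W \<subseteq> V \<and> D \<subseteq> ?K \<union> G \<and> isomorphic_copy VF EF W D"
    and disj: "disjoint_family_on fst C" and cover: "(\<Union>(W, D)\<in>C. W) = V"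
    using factor unfolding has_factor_def by (elim exE conjE) (rule that)
  have copy: "fst p \<subseteq> V" "snd p \<subseteq> ?K \<union> G" "isomorphic_copy VF EF (fst p) (snd p)" if "p \<in> C" for p
    using bspec[OF C that] by (simp_all add: case_prod_beta)
  have card_copy: "card (fst p) = card VF" if p: "p \<in> C" for p
    using copy(3)[OF p] by (auto simp: isomorphic_copy_def dest: bij_betw_same_card)
  have pos: "0 < card VF" using F \<open>finite VF\<close> by (simp add: card_gt_0_iff)
  have ne: "fst p \<noteq> {}" if "p \<in> C" for p using card_copy[OF that] pos by auto
  have edge: "e \<subseteq> fst p \<and> e \<noteq> {}" if pe: "p \<in> C" "e \<in> snd p" for p e
  proof -
    obtain \<phi> where \<phi>: "bij_betw \<phi> VF (fst p)" "snd p = (\<lambda>e. \<phi> ` e) ` EF"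
      using copy(3)[OF pe(1)] by (auto simp: isomorphic_copy_def)
    then obtain e' where "e' \<in> EF" "e = \<phi> ` e'" using pe(2) by blast
    moreover from this EF have "e' \<subseteq> VF" "e' \<noteq> {}" by (auto simp: nsets_def)
    ultimately show ?thesis using \<phi>(1) by (auto simp: bij_betw_def)
  qed
  have same: "p = p'" if "p \<in> C" "p' \<in> C" "fst p \<inter> fst p' \<noteq> {}" for p p'
    using disj that unfolding disjoint_family_on_def by blast
  \<comment> \<open>The family C consists of pairs, and disjointness is demanded for different
    pairs. Two copies on one nonempty vertex set therefore coincide; this is how C turns out to be
    finite.\<close>
  have "inj_on fst C"
  proof (rule inj_onI)
    fix p p' assume "p \<in> C" "p' \<in> C" "fst p = fst p'"
    then show "p = p'" using same[of p p'] ne[of p] by simp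
  qed
  moreover have "finite (fst ` C)"
    by (rule finite_subset[of _ "Pow V"]) (use copy(1) \<open>finite V\<close> in auto)
  ultimately have "finite C" by (simp add: finite_image_iff)
  have "card V = card (\<Union>p\<in>C. fst p)" using cover by (simp add: case_prod_beta')
  also have "\<dots> = (\<Sum>p\<in>C. card (fst p))"
  proof (rule card_UN_disjoint[OF \<open>finite C\<close>])
    show "\<forall>p\<in>C. finite (fst p)" using copy(1) \<open>finite V\<close> by (meson finite_subset)
    show "\<forall>p\<in>C. \<forall>q\<in>C. p \<noteq> q \<longrightarrow> fst p \<inter> fst q = {}" using same by blast
  qed
  also have "\<dots> = card C * card VF" using card_copy by simp
  finally have card_V: "card V = card C * card VF" .

  define P where "P = {p \<in> C. snd p \<subseteq> ?K}"
  have "finite P" using \<open>finite C\<close> by (simp add: P_def)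
  have "\<exists>e. e \<in> snd p \<inter> G" if "p \<in> C - P" for p
    using that copy(2)[of p] unfolding P_def by blast
  then obtain g where g: "\<And>p. p \<in> C - P \<Longrightarrow> g p \<in> snd p \<inter> G" by metis
  have "inj_on g (C - P)"
  proof (rule inj_onI)
    fix p q assume pq: "p \<in> C - P" "q \<in> C - P" "g p = g q"
    have "g p \<subseteq> fst p" "g p \<noteq> {}" "g q \<subseteq> fst q"
      using edge[of p "g p"] edge[of q "g q"] g[OF pq(1)] g[OF pq(2)] pq by auto
    then have "fst p \<inter> fst q \<noteq> {}" using pq(3) by auto
    then show "p = q" using same pq by blast
  qed
  then have "card (C - P) \<le> card G"
    by (rule card_inj_on_le) (use g \<open>finite G\<close> in auto)
  then have C_le: "card C \<le> card P + card G"
    using card_Diff_subset[of P C] \<open>finite P\<close> card_mono[OF \<open>finite C\<close>, of P] by (auto simp: P_def)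

  have s_le: "?s \<le> card {v \<in> fst p. c v = i}" if "p \<in> P" for p
  proof -
    have p: "p \<in> C" "snd p \<subseteq> ?K" using that by (auto simp: P_def)
    obtain \<phi> where \<phi>: "bij_betw \<phi> VF (fst p)" "snd p = (\<lambda>e. \<phi> ` e) ` EF"
      using copy(3)[OF p(1)] by (auto simp: isomorphic_copy_def)
    have "proper_colouring VF EF (chromatic_number VF EF) (\<lambda>v. c (\<phi> v))"
      unfolding proper_colouring_def
    proof (intro conjI ballI impI)
      fix v assume "v \<in> VF"
      then have "\<phi> v \<in> V" using \<phi>(1) copy(1)[OF p(1)] by (auto simp: bij_betw_def)
      then show "c (\<phi> v) < chromatic_number VF EF" by (rule c)
    next
      fix u v assume "{u, v} \<in> EF"
      then have "\<phi> ` {u, v} \<in> ?K" using p(2) \<phi>(2) by blast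
      then have "{\<phi> u, \<phi> v} \<in> ?K" by simp
      then show "c (\<phi> u) \<noteq> c (\<phi> v)" by (simp add: doubleton_in_complete_multipartite)
    qed
    then have "?s \<le> card {v \<in> VF. c (\<phi> v) = i}" using i by (rule smallest_class_le)
    also have "\<dots> = card (\<phi> ` {v \<in> VF. c (\<phi> v) = i})"
      using \<phi>(1) by (intro card_image[symmetric]) (auto simp: bij_betw_def inj_on_def)
    also have "\<phi> ` {v \<in> VF. c (\<phi> v) = i} = {v \<in> fst p. c v = i}"
      using \<phi>(1) by (auto simp: bij_betw_def)
    finally show ?thesis .
  qed
  have "?s * card P \<le> (\<Sum>p\<in>P. card {v \<in> fst p. c v = i})"
    using sum_mono[of P "\<lambda>_. ?s", OF s_le] by (simp add: mult.commute)
  also have "\<dots> = card (\<Union>p\<in>P. {v \<in> fst p. c v = i})"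
  proof (rule card_UN_disjoint[OF \<open>finite P\<close>, symmetric])
    show "\<forall>p\<in>P. finite {v \<in> fst p. c v = i}"
      using copy(1) unfolding P_def by (intro ballI finite_subset[OF _ \<open>finite V\<close>]) blast
    show "\<forall>p\<in>P. \<forall>q\<in>P. p \<noteq> q \<longrightarrow> {v \<in> fst p. c v = i} \<inter> {v \<in> fst q. c v = i} = {}"
      using same unfolding P_def by blast
  qed
  also have "\<dots> \<le> card {v \<in> V. c v = i}"
    using copy(1) \<open>finite V\<close> unfolding P_def by (intro card_mono) auto
  finally have "?s * card P \<le> card {v \<in> V. c v = i}" .
  moreover have "?s * card C \<le> ?s * card P + ?s * card G"
    using C_le by (metis distrib_left mult_le_mono2)
  ultimately have "?s * card C \<le> card {v \<in> V. c v = i} + ?s * card G" by linarith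
  then show ?thesis unfolding card_V
    by (metis mult.assoc mult.commute mult_le_mono2)
qed

section \<open>Below the threshold\<close>

text \<open>The last class collects what the \<open>k - 1\<close> blocks of length m leave over. It
  is the scarce class against which copies of F are counted. The shift by 1 is there because the
  vertices are numbered from 1.\<close>

definition blocks :: "nat \<Rightarrow> nat \<Rightarrow> nat \<Rightarrow> nat" where
  "blocks m k v = min ((v - 1) div m) (k - 1)"

lemma card_block_le:
  assumes "0 < m" "i < k - 1"
  shows "card {v \<in> {1..n}. blocks m k v = i} \<le> m"
proof -
  have "{v \<in> {1..n}. blocks m k v = i} \<subseteq> {i * m + 1..i * m + m}"
  proof
    fix v assume v: "v \<in> {v \<in> {1..n}. blocks m k v = i}"
    then have "(v - 1) div m = i" using assms by (auto simp: blocks_def min_def split: if_splits)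
    then have "i * m \<le> v - 1" "v - 1 < i * m + m"
      using mod_less_divisor[OF assms(1), of "v - 1"] div_mult_mod_eq[of "v - 1" m] by simp_all
    then show "v \<in> {i * m + 1..i * m + m}" using v by auto
  qed
  then have "card {v \<in> {1..n}. blocks m k v = i} \<le> card {i * m + 1..i * m + m}"
    by (intro card_mono) auto
  then show ?thesis by simp
qed

lemma card_last_block_le:
  assumes "0 < m"
  shows "card {v \<in> {1..n}. blocks m k v = k - 1} \<le> n - (k - 1) * m"
proof -
  have "{v \<in> {1..n}. blocks m k v = k - 1} \<subseteq> {(k - 1) * m + 1..n}"
  proof
    fix v assume v: "v \<in> {v \<in> {1..n}. blocks m k v = k - 1}"
    then have "k - 1 \<le> (v - 1) div m" by (auto simp: blocks_def min_def split: if_splits)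
    then have "(k - 1) * m \<le> v - 1" using assms by (simp add: less_eq_div_iff_mult_less_eq)
    then show "v \<in> {(k - 1) * m + 1..n}" using v by auto
  qed
  then have "card {v \<in> {1..n}. blocks m k v = k - 1} \<le> card {(k - 1) * m + 1..n}"
    by (intro card_mono) auto
  then show ?thesis by simp
qed

text \<open>Divided by \<open>card V\<close>, this says that \<chi>(F) - 1 classes of relative size
  1 - \<alpha>, the largest the degree condition allows, exceed the fraction 1 - \<sigma>(F) / f.
  Fewer than \<sigma>(F) n / f vertices then remain for the last class.\<close>

lemma critical_chromatic_number_bound:
  assumes "simple_graph V E" "chromatic_number V E \<ge> 2" "\<alpha> < 1 - 1 / critical_chromatic_number V E"
  shows "real (card V) - real (smallest_class V E)
    < (1 - \<alpha>) * (real (chromatic_number V E) - 1) * real (card V)"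
proof -
  let ?k = "real (chromatic_number V E)" and ?f = "real (card V)" and ?s = "real (smallest_class V E)"
  have b: "0 < smallest_class V E" "chromatic_number V E - 1 + smallest_class V E \<le> card V"
    using smallest_class_bounds[OF assms(1)] assms(2) by auto
  have k: "1 < ?k" using assms(2) by simp
  have "?s < ?f" using b(2) assms(2) by linarith
  have "0 < ?f" using b assms(2) by linarith
  have "1 / critical_chromatic_number V E = (?f - ?s) / ((?k - 1) * ?f)"
    using k \<open>?s < ?f\<close> \<open>0 < ?f\<close> by (simp add: critical_chromatic_number_def)
  then have "(?f - ?s) / ((?k - 1) * ?f) < 1 - \<alpha>" using assms(3) by simp
  then show ?thesis using k \<open>0 < ?f\<close> by (simp add: pos_divide_less_eq mult.assoc)
qed

text \<open>The whole obstruction is deterministic: any finite set G of added edges that completes a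
  factor must be of linear size. Randomness enters only when G is taken to be the geometric
  graph.\<close>

lemma extremal_graphs_exist:
  assumes F: "simple_graph VF EF" "chromatic_number VF EF \<ge> 2"
    and \<alpha>: "0 < \<alpha>" "\<alpha> < 1 - 1 / critical_chromatic_number VF EF"
  obtains H \<epsilon> n0 where "min_degree_sequence {n. 0 < n \<and> card VF dvd n} \<alpha> H" "0 < \<epsilon>"
    "\<And>n G. n0 \<le> n \<Longrightarrow> finite G \<Longrightarrow> has_factor VF EF {1..n} (H n \<union> G) \<Longrightarrow> \<epsilon> * real n \<le> real (card G)"
proof -
  define k where "k = chromatic_number VF EF"
  define f where "f = card VF"
  define s where "s = smallest_class VF EF"
  \<comment> \<open>The largest relative size of a colour class compatible with the degree
    condition.\<close>
  define a where "a = 1 - \<alpha>"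
  have k: "2 \<le> k" using F by (simp add: k_def)
  have b: "0 < s" "k * s \<le> f" "k - 1 + s \<le> f"
    using smallest_class_bounds[OF F(1)] k by (auto simp: k_def f_def s_def)
  have "0 < f" using b k by linarith
  have VF: "VF \<noteq> {}" using \<open>0 < f\<close> by (auto simp: f_def)
  have key: "real f - real s < a * (real k - 1) * real f"
    using critical_chromatic_number_bound[OF F \<alpha>(2)] by (simp add: a_def f_def k_def s_def)
  \<comment> \<open>Gives \<open>1 < a * n\<close> for every n from f on, so the block length is
    positive and a class with a single vertex is always admissible.\<close>
  have af: "1 < a * real f"
  proof -
    have "real k - 1 \<le> real f - real s" using b k by linarith
    also have "\<dots> < a * (real k - 1) * real f" by (rule key)
    finally have "1 * (real k - 1) < (a * real f) * (real k - 1)" by (simp add: algebra_simps)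
    then show ?thesis using k by simp
  qed
  \<comment> \<open>k classes of relative size a have room to spare, so for large n the last class
    also respects the bound \<open>a * n\<close>, in spite of the rounding of the others.\<close>
  have ak: "1 < a * real k"
  proof -
    have "real k * real s \<le> real f" using b(2) by (metis of_nat_le_iff of_nat_mult)
    then have "real f * (real k - 1) \<le> real k * (real f - real s)" by (simp add: algebra_simps)
    also have "\<dots> < real k * (a * (real k - 1) * real f)" using key k by simp
    finally have "1 * (real f * (real k - 1)) < (a * real k) * (real f * (real k - 1))"
      by (simp add: algebra_simps)
    then show ?thesis using k \<open>0 < f\<close> by simp
  qed
  \<comment> \<open>Without rounding the last class has \<open>n - (k - 1) * a * n\<close> vertices
    if this is not negative; f times this number is \<open>s * n - \<gamma> * n\<close>. Thus
    \<gamma> measures the deficit against s vertices per copy.\<close>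
  define \<gamma> where "\<gamma> = (real k - 1) * a * real f - (real f - real s)"
  have "0 < \<gamma>" using key by (simp add: \<gamma>_def algebra_simps)
  \<comment> \<open>The first bound in the inner \<open>max\<close> keeps the last class below
    \<open>a * n\<close> after rounding; the second makes the rounding error, at most
    \<open>f * (k - 1)\<close> after scaling by f, smaller than half the deficit.\<close>
  define n0 where "n0 = max f (nat \<lceil>max (real k / (a * real k - 1)) (2 * real k * real f / \<gamma>)\<rceil>)"
  have n0: "f \<le> n" "real k \<le> real n * (a * real k - 1)" "2 * real k * real f \<le> real n * \<gamma>"
    if "n0 \<le> n" for n
  proof -
    show "f \<le> n" using that by (simp add: n0_def)
    have "max (real k / (a * real k - 1)) (2 * real k * real f / \<gamma>) \<le> real n"
      using that unfolding n0_def by linarith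
    then have "real k / (a * real k - 1) \<le> real n" "2 * real k * real f / \<gamma> \<le> real n" by auto
    then show "real k \<le> real n * (a * real k - 1)" "2 * real k * real f \<le> real n * \<gamma>"
      using ak \<open>0 < \<gamma>\<close> by (auto simp: pos_divide_le_eq)
  qed
  define m where "m = (\<lambda>n :: nat. nat \<lfloor>a * real n\<rfloor>)"
  have a_n: "1 < a * real n" if "f \<le> n" for n
  proof -
    have "0 < a * real f" using af by linarith
    then have "0 < a" using \<open>0 < f\<close> by (simp add: zero_less_mult_iff)
    then have "a * real f \<le> a * real n" using that by simp
    then show ?thesis using af by linarith
  qed
  have m: "0 < m n" "real (m n) \<le> a * real n" "a * real n - 1 \<le> real (m n)" if "f \<le> n" for n
    using a_n[OF that] unfolding m_def by linarith+
  \<comment> \<open>The first \<open>k - 1\<close> blocks may already exhaust \<open>{1..n}\<close>;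
    the subtraction on naturals is then truncated, whence the \<open>max 0\<close>.\<close>
  have last: "real (n - (k - 1) * m n) \<le> max 0 (real n - (real k - 1) * (a * real n - 1))" if "f \<le> n" for n
  proof -
    have "(real k - 1) * (a * real n - 1) \<le> (real k - 1) * real (m n)"
      using m(3)[OF that] k by (intro mult_left_mono) auto
    moreover have "real ((k - 1) * m n) = (real k - 1) * real (m n)" using k by (simp add: of_nat_diff)
    ultimately show ?thesis by linarith
  qed
  \<comment> \<open>The degree condition is demanded for small n too. There all vertices get
    different colours and the graph is complete.\<close>
  define c where "c = (\<lambda>n v. if n < n0 then v else blocks (m n) k v)"
  define H where "H = (\<lambda>n. complete_multipartite {1..n} (c n))"
  have "min_degree_sequence {n. 0 < n \<and> card VF dvd n} \<alpha> H"
    unfolding min_degree_sequence_def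
  proof (intro ballI)
    fix n assume n: "n \<in> {n. 0 < n \<and> card VF dvd n}"
    then have "f \<le> n" by (auto simp: f_def dvd_imp_le)
    have "real (card {w \<in> {1..n}. c n w = c n v}) \<le> (1 - \<alpha>) * real (card {1..n})" if v: "v \<in> {1..n}" for v
    proof (cases "n < n0")
      case True
      then have "{w \<in> {1..n}. c n w = c n v} = {v}" using v by (auto simp: c_def)
      then show ?thesis using a_n[OF \<open>f \<le> n\<close>] by (simp add: a_def)
    next
      case False
      then have c: "c n = blocks (m n) k" by (simp add: c_def)
      show ?thesis
      proof (cases "c n v < k - 1")
        case True
        then have "card {w \<in> {1..n}. c n w = c n v} \<le> m n"
          unfolding c using m(1)[OF \<open>f \<le> n\<close>] by (intro card_block_le) auto
        then show ?thesis using m(2)[OF \<open>f \<le> n\<close>] by (simp add: a_def)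
      next
        case False
        then have "c n v = k - 1" by (simp add: c blocks_def)
        then have "card {w \<in> {1..n}. c n w = c n v} \<le> n - (k - 1) * m n"
          unfolding c using card_last_block_le[OF m(1)[OF \<open>f \<le> n\<close>], of n k] by simp
        moreover have "real n - (real k - 1) * (a * real n - 1) \<le> a * real n"
          using n0(2)[of n] \<open>\<not> n < n0\<close> by (simp add: algebra_simps)
        moreover have "0 \<le> a * real n" using a_n[OF \<open>f \<le> n\<close>] by linarith
        ultimately have "real (card {w \<in> {1..n}. c n w = c n v}) \<le> a * real n"
          using last[OF \<open>f \<le> n\<close>] by linarith
        then show ?thesis by (simp add: a_def)
      qed
    qed
    then show "simple_graph {1..n} (H n) \<and> \<alpha> * real n \<le> real (min_degree {1..n} (H n))"
      using min_degree_complete_multipartite_ge[of "{1..n}" "c n" \<alpha>] n by (simp add: H_def)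
  qed
  \<comment> \<open>The two terms belong to the two values of the \<open>max 0\<close>. If the last
    class is empty, no copy lies inside H and G supplies an edge to each of the n / f copies;
    otherwise the deficit \<gamma> n / 2, divided by \<open>f * s\<close>, must be made up by
    G.\<close>
  moreover have "min (1 / real f) (\<gamma> / (2 * real f * real s)) * real n \<le> real (card G)"
    if n: "n0 \<le> n" and "finite G" and factor: "has_factor VF EF {1..n} (H n \<union> G)" for n G
  proof -
    have "f \<le> n" using n0(1)[OF n] .
    have c: "c n = blocks (m n) k" using n by (simp add: c_def)
    let ?L = "card {v \<in> {1..n}. c n v = k - 1}"
    have "s * card {1..n} \<le> f * (?L + s * card G)"
      unfolding s_def f_def
    proof (rule factor_of_multipartite_Un[OF F(1) VF _ \<open>finite G\<close>])
      show "has_factor VF EF {1..n} (complete_multipartite {1..n} (c n) \<union> G)"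
        using factor by (simp add: H_def)
      show "c n v < chromatic_number VF EF" for v using k by (simp add: c blocks_def flip: k_def)
      show "k - 1 < chromatic_number VF EF" using k by (simp flip: k_def)
    qed simp
    then have "real (s * n) \<le> real (f * (?L + s * card G))" 
      by (simp only: of_nat_le_iff card_atLeastAtMost diff_Suc_1)
    then have 1: "real s * real n \<le> real f * real ?L + real f * real s * real (card G)"
      by (simp add: algebra_simps)
    have "?L \<le> n - (k - 1) * m n" unfolding c by (rule card_last_block_le[OF m(1)[OF \<open>f \<le> n\<close>]])
    then have "real ?L \<le> max 0 (real n - (real k - 1) * (a * real n - 1))"
      using last[OF \<open>f \<le> n\<close>] by linarith
    then have "real f * real ?L \<le> real f * max 0 (real n - (real k - 1) * (a * real n - 1))"
      by (intro mult_left_mono) auto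
    also have "\<dots> = max 0 (real f * (real n - (real k - 1) * (a * real n - 1)))"
      by (simp add: max_def mult_le_0_iff zero_le_mult_iff)
    also have "real f * (real n - (real k - 1) * (a * real n - 1))
        = real s * real n - \<gamma> * real n + real f * (real k - 1)"
      by (simp add: \<gamma>_def algebra_simps)
    also have "\<dots> \<le> real s * real n - \<gamma> * real n / 2"
      using n0(3)[OF n] by (simp add: algebra_simps)
    finally have 2: "real f * real ?L \<le> max 0 (real s * real n - \<gamma> * real n / 2)"
      by (simp add: max_def split: if_splits)
    have "min (real n * real s) (\<gamma> * real n / 2) \<le> real f * real s * real (card G)"
      using 1 2 unfolding mult.commute[of "real n"] by linarith
    moreover have "min (1 / real f) (\<gamma> / (2 * real f * real s)) * real n * (real f * real s)
        = min (real n * real s) (\<gamma> * real n / 2)"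
      using \<open>0 < f\<close> b(1) by (simp add: min_mult_distrib_right)
    ultimately have "min (1 / real f) (\<gamma> / (2 * real f * real s)) * real n * (real f * real s)
        \<le> real (card G) * (real f * real s)" by (simp add: mult_ac)
    then show ?thesis using \<open>0 < f\<close> b(1) by simp
  qed
  moreover have "0 < min (1 / real f) (\<gamma> / (2 * real f * real s))"
    using \<open>0 < f\<close> b(1) \<open>0 < \<gamma>\<close> by simp
  ultimately show ?thesis using that by blast
qed

text \<open>The property forces at least \<epsilon> n geometric edges, while their expected number
  is at most n^2 (2r)^d, that is, n times (2 r / n^(-1/d))^d. By Markov's inequality the probability
  is at most the latter power over \<epsilon>. The graphs H are fixed before r, as the order of
  quantifiers in the threshold demands.\<close>

lemma perturbed_prob_tendsto_0:
  assumes "0 < \<epsilon>"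
    and many: "\<And>n G. n0 \<le> n \<Longrightarrow> finite G \<Longrightarrow> P {1..n} (H n \<union> G) \<Longrightarrow> \<epsilon> * real n \<le> real (card G)"
    and r: "\<forall>n\<in>N. 0 \<le> r n"
      "r \<in> o[inf sequentially (principal N)](\<lambda>n. real n powr (- 1 / real CARD('d)))"
  shows "((\<lambda>n. perturbed_prob TYPE('d::finite) P (H n) n (r n)) \<longlongrightarrow> 0)
    (inf sequentially (principal N))"
proof (rule tendsto_sandwich)
  let ?F = "inf sequentially (principal N)"
  let ?d = "CARD('d)"
  let ?\<rho> = "\<lambda>n. real n powr (- 1 / real ?d)"
  show "eventually (\<lambda>n. 0 \<le> perturbed_prob TYPE('d) P (H n) n (r n)) ?F"
    unfolding perturbed_prob_def by simp
  have in_N: "eventually (\<lambda>n. n \<in> N) ?F"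
    unfolding eventually_inf_principal by simp
  have large: "eventually (\<lambda>n. max 1 n0 \<le> n) ?F"
    using filter_leD[OF inf_le1 eventually_ge_at_top[of "max 1 n0"]] .
  show "eventually (\<lambda>n. perturbed_prob TYPE('d) P (H n) n (r n) \<le> (2 * (r n / ?\<rho> n)) ^ ?d / \<epsilon>) ?F"
    using in_N large
  proof eventually_elim
    case (elim n)
    have n: "0 < real n" "n0 \<le> n" using elim by auto
    have "0 \<le> r n" using r(1) elim by blast
    interpret U: prob_space "uniform_points n :: (nat \<Rightarrow> real ^ 'd) measure"
      by (rule prob_space_uniform_points)
    have "perturbed_prob TYPE('d) P (H n) n (r n)
        \<le> \<P>(x in (uniform_points n :: (nat \<Rightarrow> real ^ 'd) measure).
            \<epsilon> * real n \<le> real (card (geometric_edges n (r n) x)))"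
      unfolding perturbed_prob_def
      by (rule U.finite_measure_mono)
        (use many[OF n(2) finite_geometric_edges] sets_uniform_points_edges in auto)
    also have "\<dots> \<le> (real n)\<^sup>2 * (2 * r n) ^ ?d / (\<epsilon> * real n)"
      using n \<open>0 < \<epsilon>\<close> \<open>0 \<le> r n\<close> by (intro prob_many_edges_le) auto
    also have "\<dots> = (2 * r n) ^ ?d * real n / \<epsilon>"
      using n \<open>0 < \<epsilon>\<close> by (simp add: field_simps power2_eq_square)
    also have "\<dots> = (2 * (r n / ?\<rho> n)) ^ ?d / \<epsilon>"
    proof -
      have "?\<rho> n ^ ?d = ?\<rho> n powr real ?d" using n by (simp add: powr_realpow)
      also have "\<dots> = real n powr (- 1)" by (simp add: powr_powr)
      also have "\<dots> = 1 / real n" using n by (simp add: powr_minus_divide)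
      finally show ?thesis by (simp add: power_divide power_mult_distrib)
    qed
    finally show ?case .
  qed
  have "((\<lambda>n. r n / ?\<rho> n) \<longlongrightarrow> 0) ?F" using r(2) by (rule smalloD_tendsto)
  then have "((\<lambda>n. (2 * (r n / ?\<rho> n)) ^ ?d / \<epsilon>) \<longlongrightarrow> (2 * 0) ^ ?d / \<epsilon>) ?F"
    by (intro tendsto_intros) (use \<open>0 < \<epsilon>\<close> in auto)
  then show "((\<lambda>n. (2 * (r n / ?\<rho> n)) ^ ?d / \<epsilon>) \<longlongrightarrow> 0) ?F" by (simp add: power_0_left)
qed (rule tendsto_const)

theorem theorem4p3:
  fixes VF :: "'a set" and EF :: "'a set set" and \<alpha> :: real
  assumes "simple_graph VF EF"
    and "chromatic_number VF EF \<ge> 2"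
    and "0 < \<alpha>" and "\<alpha> < 1 - 1 / critical_chromatic_number VF EF"
  shows "perturbed_threshold TYPE('d::finite) {n. 0 < n \<and> card VF dvd n} \<alpha>
           (has_factor VF EF) (\<lambda>n. real n powr (- 1 / real CARD('d)))"
proof -
  have "VF \<noteq> {}"
    using smallest_class_bounds(1,3)[OF assms(1)] assms(2) by auto
  obtain H \<epsilon> n0 where H: "min_degree_sequence {n. 0 < n \<and> card VF dvd n} \<alpha> H" "0 < \<epsilon>"
    "\<And>n G. n0 \<le> n \<Longrightarrow> finite G \<Longrightarrow> has_factor VF EF {1..n} (H n \<union> G) \<Longrightarrow> \<epsilon> * real n \<le> real (card G)"
    by (rule extremal_graphs_exist[OF assms]) blast
  show ?thesis
    unfolding perturbed_threshold_def
  proof (intro conjI allI impI exI[of _ H])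
    fix H' r
    assume "min_degree_sequence {n. 0 < n \<and> card VF dvd n} \<alpha> H'"
      and "(\<forall>n\<in>{n. 0 < n \<and> card VF dvd n}. 0 \<le> r n) \<and>
        r \<in> \<omega>[inf sequentially (principal {n. 0 < n \<and> card VF dvd n})](\<lambda>n. real n powr (- 1 / real CARD('d)))"
    then show "((\<lambda>n. perturbed_prob TYPE('d) (has_factor VF EF) (H' n) n (r n)) \<longlongrightarrow> 1)
        (inf sequentially (principal {n. 0 < n \<and> card VF dvd n}))"
      using assms(1,3) \<open>VF \<noteq> {}\<close> by (intro perturbed_prob_tendsto_1) auto
  next
    fix r
    assume "(\<forall>n\<in>{n. 0 < n \<and> card VF dvd n}. 0 \<le> r n) \<and>
        r \<in> o[inf sequentially (principal {n. 0 < n \<and> card VF dvd n})](\<lambda>n. real n powr (- 1 / real CARD('d)))"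
    then show "((\<lambda>n. perturbed_prob TYPE('d) (has_factor VF EF) (H n) n (r n)) \<longlongrightarrow> 0)
        (inf sequentially (principal {n. 0 < n \<and> card VF dvd n}))"
      using perturbed_prob_tendsto_0[OF H(2,3)] by blast
  qed (rule H(1))
qed

end
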